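(* Let $N\ge k\ge 1$ be integers and let $\mathcal I=(\mathcal F_1,\dots,\mathcal F_N;u_1,\dots,u_N)$ be an instance of the Bayesian persuasion game with $k$ selection, where the priors $\mathcal F_i$ are arbitrary independent distributions on $[0,1]$ and each utility function $u_i:[0,1]\to\mathbb R_{\ge 0}$ is continuous, weakly increasing, and satisfies $u_i(v)>0$ for all $v>0$. If a Nash equilibrium exists, then the price of anarchy of $\mathcal I$ is at most $11+5\sqrt5$; that is, for every Nash equilibrium $\mathcal Z$ of $\mathcal I$, $$\mathrm{SW}^{\max}(\mathcal I)\le (11+5\sqrt5)\cdot \mathrm{SW}(\mathcal Z).$$
   Context: Model. There are $N$ agents and a principal who selects $k$ agents ($1\le k\le N$). Agent $i$ has a value $v_i\sim\mathcal F_i$, where $\mathcal F_i$ is a probability distribution on $[0,1]$; values are independent across agents. Agent $i$'s strategy is a signaling scheme $\mathcal Z_i=(\Sigma_i,\pi_i)$, where $\Sigma_i$ is a measurable space of signals and $\pi_i$ is a probability kernel from $[0,1]$ to $\Sigma_i$: given $v_i$, the signal $\sigma_i$ is drawn from $\pi_i(\cdot\mid v_i)$, independently across agents. $\Pi_i$ is the induced law of $\sigma_i$ and $\boldsymbol\Pi=\Pi_1\times\cdots\times\Pi_N$ is the law of $\boldsymbol\sigma=(\sigma_1,\dots,\sigma_N)$. Let $e_i(\sigma_i)=\mathbb E[v_i\mid\sigma_i]$ be the posterior mean, and $e_{(1)}(\boldsymbol\sigma)\ge\cdots\ge e_{(N)}(\boldsymbol\sigma)$ the sorted posterior means. The principal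 selects the $k$ agents with the highest posterior means, breaking ties uniformly at random: with $\mathcal W=\{i:e_i(\sigma_i)>e_{(k)}\}$ and $\mathcal T=\{i:e_i(\sigma_i)=e_{(k)}\}$, agent $i$ is selected with probability $\rho_i(\boldsymbol\sigma)=1$ if $i\in\mathcal W$, $(k-|\mathcal W|)/|\mathcal T|$ if $i\in\mathcal T$, and $0$ otherwise. An agent selected with value $v$ gets utility $u_i(v)$, and otherwise $0$. For a strategy profile $\mathcal Z=(\mathcal Z_1,\dots,\mathcal Z_N)$: $u_i(\mathcal Z)=\mathbb E_{\boldsymbol\sigma\sim\boldsymbol\Pi}[\rho_i(\boldsymbol\sigma)\,\mathbb E[u_i(v_i)\mid\sigma_i]]$ and the social welfare is $\mathrm{SW}(\mathcal Z)=\mathbb E_{\boldsymbol\sigma\sim\boldsymbol\Pi}[\sum_{j=1}^k e_{(j)}(\boldsymbol\sigma)]$. $\mathcal Z$ is a Nash equilibrium if for every agent $i$ and every signaling scheme $\mathcal Z_i'$, $u_i(\mathcal Z)\ge u_i(\mathcal Z_i',\mathcal Z_{-i})$. The first-best welfare is $\mathrm{SW}^{\max}(\mathcal I)=\mathbb E[\max_{S\subseteq[N],|S|=k}\sum_{i\in S}v_i]$. The price of anarchy is $\mathrm{SW}^{\max}(\mathcal I)/\inf_{\mathcal Z}\mathrm{SW}(\mathcal Z)$, the infimum over Nash equilibria (assumed to exist). *)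

theory Defs
  imports "HOL-Probability.Probability"
begin

text \<open>
  Agents are \<open>{1..N}\<close>. Priors live on \<open>[0,1]\<close> with its Borel sets, so a prior is an element of
  \<open>space (prob_algebra unit_borel)\<close>. Values of functions on \<open>real\<close> outside \<open>[0,1]\<close> never matter.
\<close>

abbreviation unit_borel :: "real measure" where
  "unit_borel \<equiv> restrict_space borel {0..1}"

text \<open>
  A signaling scheme is a measurable space of signals (given as a \<open>measure\<close>, of which only the
  space and the sigma-algebra are used) and a kernel into it. The type \<open>'s\<close> is a universe of
  signals: each scheme chooses its own subset of \<open>'s\<close> and its own sigma-algebra there, so
  different agents, and deviations, may use different signal spaces. Since HOL cannot quantify
  over types inside a formula, ``every signaling scheme'' means every scheme whose signals are
  drawn from \<open>'s\<close>; for this to be meaningful, \<open>'s\<close> should be at least as large as \<open>real\<close>, so that,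
  for instance, full revelation is a possible deviation.
\<close>

record 's scheme =
  sigspace :: "'s measure"
  kern :: "real \<Rightarrow> 's measure"

definition signaling_scheme :: "'s scheme \<Rightarrow> bool" where
  "signaling_scheme Z \<longleftrightarrow> kern Z \<in> unit_borel \<rightarrow>\<^sub>M prob_algebra (sigspace Z)"

definition joint_law :: "real measure \<Rightarrow> 's scheme \<Rightarrow> (real \<times> 's) measure" where
  "joint_law F Z = do {
     v \<leftarrow> F;
     s \<leftarrow> kern Z v;
     return (unit_borel \<Otimes>\<^sub>M sigspace Z) (v, s)
   }"

definition signal_law :: "real measure \<Rightarrow> 's scheme \<Rightarrow> 's measure" where
  "signal_law F Z = F \<bind> kern Z"

text \<open>
  The library's \<open>real_cond_exp\<close> is a function on the sample space of pairs (value, signal),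
  measurable for the sigma-algebra generated by the signal. The conditional expectation as a
  function of the signal is a measurable factor of it. It exists (lemma
  \<open>cond_exp_given_signal\<close> below) and is unique up to null sets of the law of the signal.
\<close>

definition signal_algebra :: "real measure \<Rightarrow> 's scheme \<Rightarrow> (real \<times> 's) measure" where
  "signal_algebra F Z = vimage_algebra (space (joint_law F Z)) snd (sigspace Z)"

definition is_cond_exp_given_signal ::
    "real measure \<Rightarrow> 's scheme \<Rightarrow> (real \<Rightarrow> real) \<Rightarrow> ('s \<Rightarrow> real) \<Rightarrow> bool" where
  "is_cond_exp_given_signal F Z f g \<longleftrightarrow>
     g \<in> borel_measurable (sigspace Z) \<and>
     (AE x in joint_law F Z.
        g (snd x) = real_cond_exp (joint_law F Z) (signal_algebra F Z) (\<lambda>y. f (fst y)) x)"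

definition cond_exp_given_signal ::
    "real measure \<Rightarrow> 's scheme \<Rightarrow> (real \<Rightarrow> real) \<Rightarrow> 's \<Rightarrow> real" where
  "cond_exp_given_signal F Z f = (SOME g. is_cond_exp_given_signal F Z f g)"

definition posterior_mean :: "real measure \<Rightarrow> 's scheme \<Rightarrow> 's \<Rightarrow> real" where
  "posterior_mean F Z = cond_exp_given_signal F Z (\<lambda>v. v)"

text \<open>The \<open>j\<close>-th largest of \<open>x 1, \<dots>, x N\<close>, for \<open>1 \<le> j \<le> N\<close>.\<close>

definition kth_largest :: "nat \<Rightarrow> (nat \<Rightarrow> real) \<Rightarrow> nat \<Rightarrow> real" where
  "kth_largest N x j = rev (sort (map x [1..<Suc N])) ! (j - 1)"

definition sel_prob :: "nat \<Rightarrow> nat \<Rightarrow> (nat \<Rightarrow> real) \<Rightarrow> nat \<Rightarrow> real" where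
  "sel_prob N k e i =
     (let W = {j \<in> {1..N}. e j > kth_largest N e k};
          T = {j \<in> {1..N}. e j = kth_largest N e k}
      in if i \<in> W then 1
         else if i \<in> T then (real k - real (card W)) / real (card T)
         else 0)"

definition profile_law ::
    "nat \<Rightarrow> (nat \<Rightarrow> real measure) \<Rightarrow> (nat \<Rightarrow> 's scheme) \<Rightarrow> (nat \<Rightarrow> 's) measure" where
  "profile_law N F Z = (\<Pi>\<^sub>M i\<in>{1..N}. signal_law (F i) (Z i))"

definition posterior_means ::
    "(nat \<Rightarrow> real measure) \<Rightarrow> (nat \<Rightarrow> 's scheme) \<Rightarrow> (nat \<Rightarrow> 's) \<Rightarrow> nat \<Rightarrow> real" where
  "posterior_means F Z \<sigma> i = posterior_mean (F i) (Z i) (\<sigma> i)"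

definition expected_utility ::
    "nat \<Rightarrow> nat \<Rightarrow> (nat \<Rightarrow> real measure) \<Rightarrow> (nat \<Rightarrow> real \<Rightarrow> real) \<Rightarrow>
     (nat \<Rightarrow> 's scheme) \<Rightarrow> nat \<Rightarrow> real" where
  "expected_utility N k F u Z i =
     (\<integral>\<sigma>. sel_prob N k (posterior_means F Z \<sigma>) i
          * cond_exp_given_signal (F i) (Z i) (u i) (\<sigma> i) \<partial>profile_law N F Z)"

definition social_welfare ::
    "nat \<Rightarrow> nat \<Rightarrow> (nat \<Rightarrow> real measure) \<Rightarrow> (nat \<Rightarrow> 's scheme) \<Rightarrow> real" where
  "social_welfare N k F Z =
     (\<integral>\<sigma>. (\<Sum>j=1..k. kth_largest N (posterior_means F Z \<sigma>) j) \<partial>profile_law N F Z)"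

definition first_best_welfare :: "nat \<Rightarrow> nat \<Rightarrow> (nat \<Rightarrow> real measure) \<Rightarrow> real" where
  "first_best_welfare N k F =
     (\<integral>v. Max ((\<lambda>S. \<Sum>i\<in>S. v i) ` {S. S \<subseteq> {1..N} \<and> card S = k}) \<partial>(\<Pi>\<^sub>M i\<in>{1..N}. F i))"

definition nash_equilibrium ::
    "nat \<Rightarrow> nat \<Rightarrow> (nat \<Rightarrow> real measure) \<Rightarrow> (nat \<Rightarrow> real \<Rightarrow> real) \<Rightarrow>
     (nat \<Rightarrow> 's scheme) \<Rightarrow> bool" where
  "nash_equilibrium N k F u Z \<longleftrightarrow>
     (\<forall>i\<in>{1..N}. signaling_scheme (Z i)) \<and>
     (\<forall>i\<in>{1..N}. \<forall>Z'. signaling_scheme Z' \<longrightarrow>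
        expected_utility N k F u Z i \<ge> expected_utility N k F u (Z(i := Z')) i)"

text \<open>
  The quotient is taken in \<open>ereal\<close>, where \<open>x / 0 = \<infinity>\<close> for \<open>x > 0\<close> and \<open>0 / 0 = 0\<close>; a real
  quotient would hide a positive first-best welfare over zero equilibrium welfare. The first
  argument only fixes the universe of signals.
\<close>

definition price_of_anarchy ::
    "'s itself \<Rightarrow> nat \<Rightarrow> nat \<Rightarrow> (nat \<Rightarrow> real measure) \<Rightarrow> (nat \<Rightarrow> real \<Rightarrow> real) \<Rightarrow> ereal" where
  "price_of_anarchy (_ :: 's itself) N k F u =
     ereal (first_best_welfare N k F) /
     (INF Z\<in>{Z :: nat \<Rightarrow> 's scheme. nash_equilibrium N k F u Z}. ereal (social_welfare N k F Z))"

lemma borel_measurable_vimage_factor: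
  fixes h :: "'a \<Rightarrow> real"
  assumes f: "f \<in> X \<rightarrow> space M" and h: "h \<in> borel_measurable (vimage_algebra X f M)"
  shows "\<exists>g\<in>borel_measurable M. \<forall>x\<in>X. h x = g (f x)"
proof -
  have "\<exists>A. A \<in> sets M \<and> {x\<in>X. h x < of_rat q} = f -` A \<inter> X" for q :: rat
  proof -
    have "{x\<in>space (vimage_algebra X f M). h x < of_rat q} \<in> sets (vimage_algebra X f M)"
      using h by measurable
    then show ?thesis
      unfolding sets_vimage_algebra2[OF f] by auto
  qed
  then obtain A where A: "\<And>q. A q \<in> sets M" "\<And>q::rat. {x\<in>X. h x < of_rat q} = f -` A q \<inter> X"
    by metis
  define G where "G y = (INF q. if y \<in> A q then ereal (of_rat q) else \<infinity>)" for y
  have [measurable]: "A q \<in> sets M" for q by (rule A)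
  have [measurable]: "G \<in> borel_measurable M"
    unfolding G_def by measurable
  have "ereal (h x) = G (f x)" if x: "x \<in> X" for x
  proof (rule antisym)
    have mem: "f x \<in> A q \<longleftrightarrow> h x < of_rat q" for q
      using A(2)[of q] x by blast
    show "ereal (h x) \<le> G (f x)"
      unfolding G_def by (rule INF_greatest) (auto simp: mem)
    show "G (f x) \<le> ereal (h x)"
    proof (rule ereal_le_epsilon2)
      fix e :: real assume "0 < e"
      then obtain q where q: "h x < of_rat q" "of_rat q < h x + e"
        using of_rat_dense[of "h x" "h x + e"] by auto
      have "G (f x) \<le> (if f x \<in> A q then ereal (of_rat q) else \<infinity>)"
        unfolding G_def by (rule INF_lower) simp
      also have "\<dots> \<le> ereal (h x) + ereal e"
        using q by (simp add: mem)
      finally show "G (f x) \<le> ereal (h x) + ereal e" .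
    qed
  qed
  then have "\<forall>x\<in>X. h x = real_of_ereal (G (f x))"
    by (metis real_of_ereal.simps(1))
  moreover have "(\<lambda>y. real_of_ereal (G y)) \<in> borel_measurable M"
    by measurable
  ultimately show ?thesis by (intro bexI[of _ "\<lambda>y. real_of_ereal (G y)"]) auto
qed

lemma joint_law_prob:
  assumes F: "F \<in> space (prob_algebra unit_borel)" and Z: "signaling_scheme Z"
  shows "joint_law F Z \<in> space (prob_algebra (unit_borel \<Otimes>\<^sub>M sigspace Z))"
proof -
  have K: "kern Z \<in> unit_borel \<rightarrow>\<^sub>M prob_algebra (sigspace Z)"
    using Z by (simp add: signaling_scheme_def)
  have "(\<lambda>v. kern Z v \<bind> (\<lambda>s. return (unit_borel \<Otimes>\<^sub>M sigspace Z) (v, s)))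
      \<in> unit_borel \<rightarrow>\<^sub>M prob_algebra (unit_borel \<Otimes>\<^sub>M sigspace Z)"
    by (rule measurable_bind_prob_space2[OF K])
      (simp add: case_prod_eta measurable_return_prob_space)
  from measurable_bind_prob_space[OF measurable_ident_sets[OF refl] this]
  have "(\<lambda>F. F \<bind> (\<lambda>v. kern Z v \<bind> (\<lambda>s. return (unit_borel \<Otimes>\<^sub>M sigspace Z) (v, s))))
      \<in> prob_algebra unit_borel \<rightarrow>\<^sub>M prob_algebra (unit_borel \<Otimes>\<^sub>M sigspace Z)" .
  from measurable_space[OF this F] show ?thesis
    by (simp add: joint_law_def)
qed

lemma cond_exp_given_signal:
  assumes F: "F \<in> space (prob_algebra unit_borel)" and Z: "signaling_scheme Z"
  shows "is_cond_exp_given_signal F Z f (cond_exp_given_signal F Z f)"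
proof -
  let ?J = "joint_law F Z"
  have "sets ?J = sets (unit_borel \<Otimes>\<^sub>M sigspace Z)"
    using joint_law_prob[OF F Z] by (simp add: space_prob_algebra)
  then have snd: "snd \<in> space ?J \<rightarrow> space (sigspace Z)"
    using sets_eq_imp_space_eq[of ?J] by (auto simp: space_pair_measure)
  have "real_cond_exp ?J (signal_algebra F Z) (\<lambda>y. f (fst y))
      \<in> borel_measurable (signal_algebra F Z)"
    by (rule borel_measurable_cond_exp)
  then obtain g where "g \<in> borel_measurable (sigspace Z)"
    "\<forall>x\<in>space ?J. real_cond_exp ?J (signal_algebra F Z) (\<lambda>y. f (fst y)) x = g (snd x)"
    using borel_measurable_vimage_factor[OF snd] unfolding signal_algebra_def by blast
  then have "is_cond_exp_given_signal F Z f g"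
    unfolding is_cond_exp_given_signal_def by (intro conjI AE_I2) auto
  then show ?thesis
    unfolding cond_exp_given_signal_def by (rule someI[of "is_cond_exp_given_signal F Z f"])
qed

end

(*
  Fix x > 0 with k x >= 2 SW. By Markov's inequality the k-th largest posterior mean is below x with
  probability at least 1/2, so any agent who induces a posterior mean >= x wins with probability at
  least 1/2. Take the signals of agent i that win with probability at most 1/4; their posterior
  means are below x. On these signals alone, the agent can instead pool the values above a
  threshold t (with randomization at t) into a single message with posterior mean exactly x.
  Since u_i is increasing, unprofitability of this deviation bounds the probability of the pooled
  message by 4 times the winning probability of agent i, whatever u_i is; hence the expected
  excess of v_i over x on these signals is at most 4 x P(i wins). On all other signals v_i counts
  at least 1/4 towards the equilibrium welfare. Summing over i, with winning probabilities adding
  up to k,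
    SW^max <= k x + sum_i E (v_i - x)^+ <= 5 k x + 4 SW,
  which is 14 SW for k x = 2 SW, and 14 <= 11 + 5 sqrt 5.
*)
theory Submission
  imports Defs
begin

subsection \<open>Order statistics and selection probabilities\<close>

text \<open>The utility has to drop out of the equilibrium condition. On the low signals,
  unprofitability says that half the utility of the pooled values is at most the current utility.
  With threshold t, the latter is at most u(t) times the probability of winning on low signals, plus
  a quarter of the utility of the pooled values. So 1/2 - 1/4 survives on the left; pooled values
  have utility at least u(t), and u(t) cancels. The pool exists because low signals have mean below
  x: together they average at most x, and discarding small values raises the average to x. This
  happens at some t \<le> x, so every value above x is pooled, and the total pooled value is x times
  the mass of the pool, which bounds the excess. The deviation must draw its signals from the
  universe \<open>'s\<close>, which the original scheme may already exhaust. Its messages are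
  therefore real numbers injected into \<open>'s\<close>, a kept signal being replaced by its
  posterior mean. This costs nothing: selection sees only the posterior mean, and utility depends
  only on the joint law of value and posterior mean.\<close>

lemma nth_descending_iff:
  fixes ys :: "real list"
  assumes ys: "sorted_wrt (\<ge>) ys" and up: "\<And>a b. P a \<Longrightarrow> a \<le> b \<Longrightarrow> P b"
    and k: "1 \<le> k" "k \<le> length ys"
  shows "P (ys ! (k - 1)) \<longleftrightarrow> k \<le> length (filter P ys)"
proof
  have ge: "ys ! j \<le> ys ! i" if "i \<le> j" "j < length ys" for i j
    using sorted_wrt_nth_less[OF ys, of i j] that by (cases "i = j") auto
  {
    assume P: "P (ys ! (k - 1))"
    have "{..<k} \<subseteq> {i. i < length ys \<and> P (ys ! i)}"
    proof
      fix i assume "i \<in> {..<k}"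
      then show "i \<in> {i. i < length ys \<and> P (ys ! i)}"
        using k up[OF P ge[of i "k - 1"]] by auto
    qed
    from card_mono[OF _ this] show "k \<le> length (filter P ys)"
      by (simp add: length_filter_conv_card)
  next
    assume le: "k \<le> length (filter P ys)"
    show "P (ys ! (k - 1))"
    proof (rule ccontr)
      assume n: "\<not> P (ys ! (k - 1))"
      have "{i. i < length ys \<and> P (ys ! i)} \<subseteq> {..<k - 1}"
      proof
        fix i assume i: "i \<in> {i. i < length ys \<and> P (ys ! i)}"
        show "i \<in> {..<k - 1}"
        proof (rule ccontr)
          assume "i \<notin> {..<k - 1}"
          then have "ys ! i \<le> ys ! (k - 1)" using i by (intro ge) auto
          with up n i show False by blast
        qed
      qed
      from card_mono[OF _ this] le k show False
        by (simp add: length_filter_conv_card)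
    qed
  }
qed

lemma sum_eq_sum_list_upt: "(\<Sum>i\<in>{1..N}. g (x i)) = sum_list (map g (map x [1..<Suc N]))"
  for g :: "real \<Rightarrow> real" and x :: "nat \<Rightarrow> real"
  by (simp add: sum_list_distinct_conv_sum_set o_def atLeastLessThanSuc_atLeastAtMost del: upt_Suc)

text \<open>Counting replaces sorting: in a descending list the entries satisfying an upward closed
  property form an initial segment, and the length of that segment is invariant under
  permutation.\<close>

lemma kth_largest_iff:
  assumes up: "\<And>a b. P a \<Longrightarrow> a \<le> b \<Longrightarrow> P b" and k: "1 \<le> k" "k \<le> N"
  shows "P (kth_largest N x k) \<longleftrightarrow> k \<le> card {j \<in> {1..N}. P (x j)}"
proof -
  let ?xs = "map x [1..<Suc N]" and ?ys = "rev (sort (map x [1..<Suc N]))"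
  have "sorted_wrt (\<ge>) ?ys"
    by (simp add: sorted_wrt_rev del: upt_Suc)
  then have "P (?ys ! (k - 1)) \<longleftrightarrow> k \<le> length (filter P ?ys)"
    using k up by (intro nth_descending_iff) (auto simp del: upt_Suc)
  also have "length (filter P ?ys) = length (filter P ?xs)"
    by (simp only: size_mset[symmetric] mset_filter mset_rev mset_sort)
  also have "\<dots> = length (filter (\<lambda>j. P (x j)) [1..<Suc N])"
    by (simp add: filter_map o_def del: upt_Suc)
  also have "\<dots> = card {j \<in> {1..N}. P (x j)}"
    by (subst distinct_card[symmetric]) (auto simp del: upt_Suc intro!: arg_cong[where f=card])
  finally show ?thesis by (simp add: kth_largest_def)
qed

lemma le_kth_largest_iff:
  "1 \<le> k \<Longrightarrow> k \<le> N \<Longrightarrow> a \<le> kth_largest N x k \<longleftrightarrow> k \<le> card {j \<in> {1..N}. a \<le> x j}"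
  by (rule kth_largest_iff) auto

lemma less_kth_largest_iff:
  "1 \<le> k \<Longrightarrow> k \<le> N \<Longrightarrow> a < kth_largest N x k \<longleftrightarrow> k \<le> card {j \<in> {1..N}. a < x j}"
  by (rule kth_largest_iff) auto

text \<open>In the notation of \<open>sel_prob\<close> this says 0 < k - |W| \<le> |T|, so the share
  (k - |W|) / |T| of a tied agent is a genuine probability with nonzero denominator.\<close>

lemma card_ge_kth_largest:
  assumes "1 \<le> k" "k \<le> N"
  shows "card {j \<in> {1..N}. x j > kth_largest N x k} < k"
    and "k \<le> card {j \<in> {1..N}. x j > kth_largest N x k} + card {j \<in> {1..N}. x j = kth_largest N x k}"
proof -
  let ?c = "kth_largest N x k"
  show "card {j \<in> {1..N}. x j > ?c} < k"
    using less_kth_largest_iff[OF assms, of ?c x] by auto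
  have "k \<le> card {j \<in> {1..N}. x j \<ge> ?c}"
    using le_kth_largest_iff[OF assms, of ?c x] by auto
  also have "{j \<in> {1..N}. x j \<ge> ?c} = {j \<in> {1..N}. x j > ?c} \<union> {j \<in> {1..N}. x j = ?c}"
    by auto
  also have "card \<dots> \<le> card {j \<in> {1..N}. x j > ?c} + card {j \<in> {1..N}. x j = ?c}"
    by (rule card_Un_le)
  finally show "k \<le> card {j \<in> {1..N}. x j > ?c} + card {j \<in> {1..N}. x j = ?c}" .
qed

lemma sel_prob_bounds:
  assumes "1 \<le> k" "k \<le> N"
  shows "0 \<le> sel_prob N k x i" "sel_prob N k x i \<le> 1"
  using card_ge_kth_largest[OF assms, of x] by (auto simp: sel_prob_def Let_def divide_simps)

lemma sum_sel_prob:
  assumes "1 \<le> k" "k \<le> N"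
  shows "(\<Sum>i\<in>{1..N}. sel_prob N k x i) = real k"
proof -
  define W T where "W = {j \<in> {1..N}. x j > kth_largest N x k}"
    and "T = {j \<in> {1..N}. x j = kth_largest N x k}"
  have card: "card W < k" "k \<le> card W + card T"
    using card_ge_kth_largest[OF assms, of x] by (auto simp: W_def T_def)
  have "W \<inter> T = {}" by (auto simp: W_def T_def)
  have sel: "sel_prob N k x i = (if i \<in> W then 1 else 0)
      + (if i \<in> T then (real k - real (card W)) / real (card T) else 0)" for i
    using \<open>W \<inter> T = {}\<close>
    unfolding sel_prob_def Let_def W_def[symmetric] T_def[symmetric] by auto
  have "{1..N} \<inter> W = W" "{1..N} \<inter> T = T" by (auto simp: W_def T_def)
  with card show ?thesis
    by (simp add: sel sum.distrib sum.inter_restrict[symmetric])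
qed

text \<open>Subtracting the cutoff \<open>c\<close> removes the effect of ties: both sides become
  the sum of the positive parts of x i - c, which sees neither the order nor the tie-breaking. Since
  the selection probabilities add up to k, the same k c is added back on both sides.\<close>

lemma sum_kth_largest:
  assumes "1 \<le> k" "k \<le> N"
  shows "(\<Sum>j=1..k. kth_largest N x j) = (\<Sum>i\<in>{1..N}. sel_prob N k x i * x i)"
proof -
  define ys where "ys = rev (sort (map x [1..<Suc N]))"
  define c where "c = kth_largest N x k"
  have len: "length ys = N" by (simp add: ys_def del: upt_Suc)
  have kth: "kth_largest N x j = ys ! (j - 1)" for j by (simp add: kth_largest_def ys_def)
  have desc: "sorted_wrt (\<ge>) ys"
    by (simp add: ys_def sorted_wrt_rev del: upt_Suc)
  have ge: "ys ! j \<le> ys ! i" if "i \<le> j" "j < N" for i j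
    using sorted_wrt_nth_less[OF desc, of i j] that len by (cases "i = j") auto
  have "(\<Sum>j=1..k. kth_largest N x j - c) = (\<Sum>j<k. ys ! j - c)"
    by (rule sum.reindex_bij_witness[of _ Suc "\<lambda>j. j - 1"]) (auto simp: kth)
  also have "\<dots> = (\<Sum>j<k. max 0 (ys ! j - c))"
    using assms ge[of _ "k - 1"] by (intro sum.cong) (auto simp: c_def kth max_def)
  \<comment> \<open>Entries after position k are at most \<open>c\<close>, so extending the sum to
    the whole list adds only zeros.\<close>
  also have "\<dots> = (\<Sum>j<N. max 0 (ys ! j - c))"
  proof (rule sum.mono_neutral_left)
    show "\<forall>j\<in>{..<N} - {..<k}. max 0 (ys ! j - c) = 0"
      using assms ge[of "k - 1"] by (auto simp: c_def kth)
  qed (use assms in auto)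
  also have "\<dots> = sum_list (map (\<lambda>y. max 0 (y - c)) ys)"
    by (simp add: sum_list_sum_nth len atLeast0LessThan)
  also have "\<dots> = sum_list (map (\<lambda>y. max 0 (y - c)) (map x [1..<Suc N]))"
    unfolding ys_def by (simp only: sum_mset_sum_list[symmetric] mset_map mset_rev mset_sort)
  also have "\<dots> = (\<Sum>i\<in>{1..N}. max 0 (x i - c))"
    by (rule sum_eq_sum_list_upt[symmetric])
  also have "\<dots> = (\<Sum>i\<in>{1..N}. sel_prob N k x i * (x i - c))"
    by (intro sum.cong) (auto simp: sel_prob_def Let_def c_def[symmetric])
  finally have "(\<Sum>j=1..k. kth_largest N x j) - real k * c
      = (\<Sum>i\<in>{1..N}. sel_prob N k x i * x i) - (\<Sum>i\<in>{1..N}. sel_prob N k x i) * c"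
    by (simp add: sum_subtractf right_diff_distrib sum_distrib_right)
  then show ?thesis using sum_sel_prob[OF assms, of x] by simp
qed

text \<open>Moving coordinate i to \<open>a\<close> adds at most one entry to those reaching
  \<open>a\<close>, and these were fewer than k. Hence at most k entries reach \<open>a\<close>
  afterwards: either i lies strictly above the new cutoff, or \<open>a\<close> is the cutoff and
  there is room for everyone tied at it, so the share is 1. The hypothesis compares \<open>a\<close>
  with the k-th largest of all the old entries, i included.\<close>

lemma sel_prob_eq_1:
  assumes k: "1 \<le> k" "k \<le> N" and i: "i \<in> {1..N}" and a: "kth_largest N x k < a"
  shows "sel_prob N k (x(i := a)) i = 1"
proof -
  let ?x = "x(i := a)"
  define W T where "W = {j \<in> {1..N}. ?x j > kth_largest N ?x k}"
    and "T = {j \<in> {1..N}. ?x j = kth_largest N ?x k}"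
  have card: "card W < k" "k \<le> card W + card T"
    using card_ge_kth_largest[OF k, of ?x] by (auto simp: W_def T_def)
  have "{j \<in> {1..N}. a \<le> ?x j} \<subseteq> insert i {j \<in> {1..N}. a \<le> x j}" by auto
  from card_mono[OF _ this] have "card {j \<in> {1..N}. a \<le> ?x j} \<le> Suc (card {j \<in> {1..N}. a \<le> x j})"
    using card_insert_le_m1[of "Suc (card {j \<in> {1..N}. a \<le> x j})" "{j \<in> {1..N}. a \<le> x j}" i] by auto
  also have "\<dots> \<le> k"
    using a le_kth_largest_iff[OF k, of a x] by auto
  finally have le: "card {j \<in> {1..N}. a \<le> ?x j} \<le> k" .
  have cases: "kth_largest N ?x k \<le> a"
  proof (rule ccontr)
    assume *: "\<not> kth_largest N ?x k \<le> a"
    then have "k \<le> card {j \<in> {1..N}. a < ?x j}"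
      using less_kth_largest_iff[OF k, of a ?x] by auto
    \<comment> \<open>The inclusion is strict because i itself sits exactly at \<open>a\<close>; so
      more than k entries would reach \<open>a\<close>.\<close>
    also have "\<dots> < card {j \<in> {1..N}. a \<le> ?x j}"
      using i by (intro psubset_card_mono) (auto intro!: psubsetI)
    finally show False using le by simp
  qed
  have WT: "card W + card T = card {j \<in> {1..N}. kth_largest N ?x k \<le> ?x j}"
    unfolding W_def T_def by (subst card_Un_disjoint[symmetric]) (auto intro!: arg_cong[where f=card])
  have sel: "sel_prob N k ?x i
      = (if i \<in> W then 1 else if i \<in> T then (real k - real (card W)) / real (card T) else 0)"
    by (simp only: sel_prob_def Let_def W_def T_def)
  have mem: "i \<in> W \<longleftrightarrow> kth_largest N ?x k < a" "i \<in> T \<longleftrightarrow> kth_largest N ?x k = a"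
    using i by (auto simp: W_def T_def)
  have le': "card {j \<in> {1..N}. kth_largest N ?x k \<le> ?x j} \<le> k" if "kth_largest N ?x k = a"
    unfolding that by (rule le)
  show ?thesis
  proof (cases "i \<in> W")
    case True
    then show ?thesis using sel by simp
  next
    case False
    then have "kth_largest N ?x k = a" using cases mem by auto
    with le' WT card have "real k - real (card W) = real (card T)" "card T > 0" by auto
    then show ?thesis
      using sel False mem \<open>kth_largest N ?x k = a\<close> by simp
  qed
qed

section \<open>Measurability of cutoffs and selection probabilities\<close>

lemma borel_measurable_kth_largest:
  assumes k: "1 \<le> k" "k \<le> N" and [measurable]: "\<And>j. j \<in> {1..N} \<Longrightarrow> f j \<in> borel_measurable M"
  shows "(\<lambda>\<omega>. kth_largest N (\<lambda>j. f j \<omega>) k) \<in> borel_measurable M"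
proof (rule borel_measurableI_greater)
  fix a
  have "(\<lambda>\<omega>. card {j \<in> {1..N}. a < f j \<omega>}) \<in> M \<rightarrow>\<^sub>M count_space UNIV"
    by measurable
  then have "{\<omega>\<in>space M. k \<le> card {j \<in> {1..N}. a < f j \<omega>}} \<in> sets M"
    by measurable
  then show "{\<omega>\<in>space M. a < kth_largest N (\<lambda>j. f j \<omega>) k} \<in> sets M"
    by (simp only: less_kth_largest_iff[OF k])
qed

lemma borel_measurable_sel_prob:
  assumes k: "1 \<le> k" "k \<le> N" and i: "i \<in> {1..N}"
    and [measurable]: "\<And>j. j \<in> {1..N} \<Longrightarrow> f j \<in> borel_measurable M"
  shows "(\<lambda>\<omega>. sel_prob N k (\<lambda>j. f j \<omega>) i) \<in> borel_measurable M"
proof -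
  have [measurable]: "(\<lambda>\<omega>. kth_largest N (\<lambda>j. f j \<omega>) k) \<in> borel_measurable M"
    "f i \<in> borel_measurable M"
    using i k assms(4) by (auto intro!: borel_measurable_kth_largest)
  show ?thesis
    using i unfolding sel_prob_def Let_def by simp measurable
qed

subsection \<open>Conditional expectations given the signal\<close>

lemma ident_measurable_unit [measurable]: "(\<lambda>v. v) \<in> borel_measurable unit_borel"
  by (rule measurable_restrict_space1) simp

locale signaling =
  fixes F :: "real measure" and Z :: "'s scheme"
  assumes prior: "F \<in> space (prob_algebra unit_borel)" and scheme: "signaling_scheme Z"
begin

abbreviation "J \<equiv> joint_law F Z"
abbreviation "S \<equiv> sigspace Z"

lemma sets_F [measurable_cong, simp]: "sets F = sets unit_borel"
  using prior by (auto simp: space_prob_algebra)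

lemma space_F [simp]: "space F = {0..1}"
  using sets_eq_imp_space_eq[OF sets_F] by (simp add: space_restrict_space)

lemma sets_J [measurable_cong, simp]: "sets J = sets (unit_borel \<Otimes>\<^sub>M S)"
  and prob_space_J: "prob_space J"
  using joint_law_prob[OF prior scheme] by (auto simp: space_prob_algebra)

lemma space_J: "space J = {0..1} \<times> space S"
  using sets_eq_imp_space_eq[OF sets_J] by (simp add: space_pair_measure space_restrict_space)

lemma kern_measurable: "kern Z \<in> unit_borel \<rightarrow>\<^sub>M prob_algebra S"
  using scheme by (simp add: signaling_scheme_def)

lemma kern_measurable_subprob: "kern Z \<in> F \<rightarrow>\<^sub>M subprob_algebra S"
  using measurable_prob_algebraD[OF kern_measurable] by (simp cong: measurable_cong_sets)

lemma sets_kern: "v \<in> {0..1} \<Longrightarrow> sets (kern Z v) = sets S"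
  using kern_measurable by (auto simp: measurable_def space_prob_algebra space_restrict_space)

lemma prob_space_kern: "v \<in> {0..1} \<Longrightarrow> prob_space (kern Z v)"
  using kern_measurable by (auto simp: measurable_def space_prob_algebra space_restrict_space)

text \<open>The disintegration of the joint law: value first, then signal. Both marginals, and later
  the law induced by the deviation, are computed from it.\<close>

lemma nn_integral_joint_law:
  assumes [measurable]: "f \<in> borel_measurable (unit_borel \<Otimes>\<^sub>M S)"
  shows "(\<integral>\<^sup>+y. f y \<partial>J) = (\<integral>\<^sup>+v. \<integral>\<^sup>+s. f (v, s) \<partial>kern Z v \<partial>F)"
proof -
  let ?B = "unit_borel \<Otimes>\<^sub>M S"
  have "(\<lambda>v. kern Z v \<bind> (\<lambda>s. return ?B (v, s))) \<in> unit_borel \<rightarrow>\<^sub>M prob_algebra ?B"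
    by (rule measurable_bind_prob_space2[OF kern_measurable])
      (simp add: case_prod_eta measurable_return_prob_space)
  then have "(\<lambda>v. kern Z v \<bind> (\<lambda>s. return ?B (v, s))) \<in> F \<rightarrow>\<^sub>M subprob_algebra ?B"
    by (simp add: measurable_prob_algebraD cong: measurable_cong_sets)
  then have "(\<integral>\<^sup>+y. f y \<partial>J) = (\<integral>\<^sup>+v. \<integral>\<^sup>+y. f y \<partial>(kern Z v \<bind> (\<lambda>s. return ?B (v, s))) \<partial>F)"
    unfolding joint_law_def by (intro nn_integral_bind[where B="?B"]) auto
  also have "\<dots> = (\<integral>\<^sup>+v. \<integral>\<^sup>+s. f (v, s) \<partial>kern Z v \<partial>F)"
  proof (intro nn_integral_cong)
    fix v assume "v \<in> space F"
    then have v: "v \<in> {0..1}" "v \<in> space unit_borel" by (simp_all add: space_restrict_space)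
    note [measurable_cong] = sets_kern[OF v(1)]
    have "(\<lambda>s. return ?B (v, s)) \<in> S \<rightarrow>\<^sub>M subprob_algebra ?B"
      using v by (intro measurable_compose[OF measurable_Pair1' return_measurable])
    then have "(\<lambda>s. return ?B (v, s)) \<in> kern Z v \<rightarrow>\<^sub>M subprob_algebra ?B"
      by (simp add: sets_kern[OF v(1)] cong: measurable_cong_sets)
    then have "(\<integral>\<^sup>+y. f y \<partial>(kern Z v \<bind> (\<lambda>s. return ?B (v, s))))
        = (\<integral>\<^sup>+s. \<integral>\<^sup>+y. f y \<partial>return ?B (v, s) \<partial>kern Z v)"
      by (intro nn_integral_bind[where B="?B"]) auto
    also have "\<dots> = (\<integral>\<^sup>+s. f (v, s) \<partial>kern Z v)"
      using v sets_eq_imp_space_eq[OF sets_kern[OF v(1)]]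
      by (intro nn_integral_cong nn_integral_return) (auto simp: space_pair_measure)
    finally show "(\<integral>\<^sup>+y. f y \<partial>(kern Z v \<bind> (\<lambda>s. return ?B (v, s)))) = (\<integral>\<^sup>+s. f (v, s) \<partial>kern Z v)" .
  qed
  finally show ?thesis .
qed

lemma sets_signal_law [measurable_cong, simp]: "sets (signal_law F Z) = sets S"
  unfolding signal_law_def using kern_measurable_subprob by (intro sets_bind sets_kernel) auto

lemma space_signal_law [simp]: "space (signal_law F Z) = space S"
  by (rule sets_eq_imp_space_eq) simp

lemma signal_law_eq_distr: "signal_law F Z = distr J S snd"
proof (rule measure_eqI)
  fix A assume "A \<in> sets (signal_law F Z)"
  then have A [measurable]: "A \<in> sets S" by simp
  have "emeasure (signal_law F Z) A = (\<integral>\<^sup>+v. emeasure (kern Z v) A \<partial>F)"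
    unfolding signal_law_def using kern_measurable_subprob A by (intro emeasure_bind) auto
  also have "\<dots> = (\<integral>\<^sup>+v. \<integral>\<^sup>+s. indicator A s \<partial>kern Z v \<partial>F)"
    using A by (intro nn_integral_cong) (simp add: sets_kern)
  also have "\<dots> = (\<integral>\<^sup>+y. indicator A (snd y) \<partial>J)"
    by (subst nn_integral_joint_law) auto
  also have "\<dots> = emeasure (distr J S snd) A"
    by (subst nn_integral_indicator[symmetric], simp, subst nn_integral_distr) auto
  finally show "emeasure (signal_law F Z) A = emeasure (distr J S snd) A" .
qed simp

lemma F_eq_distr: "F = distr J F fst"
proof (rule measure_eqI)
  fix A assume "A \<in> sets F"
  then have [measurable]: "A \<in> sets F" "A \<in> sets unit_borel" by simp_all
  have "emeasure (distr J F fst) A = (\<integral>\<^sup>+y. indicator A (fst y) \<partial>J)"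
    by (subst nn_integral_indicator[symmetric], simp, subst nn_integral_distr) auto
  also have "\<dots> = (\<integral>\<^sup>+v. \<integral>\<^sup>+s. indicator A v \<partial>kern Z v \<partial>F)"
    by (subst nn_integral_joint_law) auto
  also have "\<dots> = (\<integral>\<^sup>+v. indicator A v \<partial>F)"
    by (intro nn_integral_cong) (simp add: prob_space.emeasure_space_1[OF prob_space_kern])
  finally show "emeasure F A = emeasure (distr J F fst) A" by simp
qed simp

lemma prob_space_signal_law: "prob_space (signal_law F Z)"
  unfolding signal_law_eq_distr by (rule prob_space.prob_space_distr[OF prob_space_J]) simp

lemma AE_signal_law_iff:
  "{s \<in> space S. P s} \<in> sets S \<Longrightarrow> (AE s in signal_law F Z. P s) \<longleftrightarrow> (AE y in J. P (snd y))"
  unfolding signal_law_eq_distr by (rule AE_distr_iff) auto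

lemma integrable_J:
  fixes f :: "real \<times> 's \<Rightarrow> real"
  assumes "f \<in> borel_measurable J" "\<And>v s. v \<in> {0..1} \<Longrightarrow> s \<in> space S \<Longrightarrow> \<bar>f (v, s)\<bar> \<le> B"
  shows "integrable J f"
  using assms by (intro finite_measure.integrable_const_bound[where B=B] AE_I2
      prob_space.finite_measure[OF prob_space_J]) (auto simp: space_J)

lemma sigma_finite_subalgebra_signal: "sigma_finite_subalgebra J (signal_algebra F Z)"
proof -
  have snd: "snd \<in> space J \<rightarrow> space S" by (auto simp: space_J)
  have "subalgebra J (signal_algebra F Z)"
    unfolding subalgebra_def signal_algebra_def
  proof
    show "sets (vimage_algebra (space J) snd S) \<subseteq> sets J"
    proof
      fix A assume "A \<in> sets (vimage_algebra (space J) snd S)"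
      then obtain C where C: "C \<in> sets S" "A = snd -` C \<inter> space J"
        unfolding sets_vimage_algebra2[OF snd] by auto
      have "snd \<in> J \<rightarrow>\<^sub>M S" by measurable
      from measurable_sets[OF this C(1)] show "A \<in> sets J" using C(2) by simp
    qed
  qed simp
  then interpret finite_measure_subalgebra J "signal_algebra F Z"
    by (intro finite_measure_subalgebra.intro finite_measure_subalgebra_axioms.intro
        prob_space.finite_measure[OF prob_space_J])
  show ?thesis by (rule sigma_finite_subalgebra_axioms)
qed

lemma measurable_signal_algebra:
  "h \<in> borel_measurable S \<Longrightarrow> (\<lambda>y. h (snd y)) \<in> borel_measurable (signal_algebra F Z)"
  unfolding signal_algebra_def
  by (rule measurable_compose[OF measurable_vimage_algebra1]) (auto simp: space_J)

lemma sets_signal_algebraE: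
  assumes "A \<in> sets (signal_algebra F Z)"
  obtains C where "C \<in> sets S" "A = snd -` C \<inter> space J"
proof -
  have snd: "snd \<in> space J \<rightarrow> space S" by (auto simp: space_J)
  show ?thesis
    using assms that unfolding signal_algebra_def sets_vimage_algebra2[OF snd] by auto
qed

section \<open>Conditional expectations tested against functions of the signal\<close>

lemma cond_exp_measurable [measurable]: "cond_exp_given_signal F Z f \<in> borel_measurable S"
  and cond_exp_AE: "AE y in J. cond_exp_given_signal F Z f (snd y)
    = real_cond_exp J (signal_algebra F Z) (\<lambda>y. f (fst y)) y"
  using cond_exp_given_signal[OF prior scheme, of f] by (auto simp: is_cond_exp_given_signal_def)

lemma posterior_mean_measurable [measurable]: "posterior_mean F Z \<in> borel_measurable S"
  unfolding posterior_mean_def by measurable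

lemma integrable_fst:
  fixes f :: "real \<Rightarrow> real"
  assumes [measurable]: "f \<in> borel_measurable unit_borel"
    and "\<And>v. v \<in> {0..1} \<Longrightarrow> \<bar>f v\<bar> \<le> B"
  shows "integrable J (\<lambda>y. f (fst y))"
  using assms(2) by (intro integrable_J[where B=B]) auto

text \<open>The pull-out property for bounded tests \<open>h\<close> of the signal. It trades a
  conditional expectation under the law of the signal for the raw quantity under the joint law, so
  that later arguments can work pointwise in the value.\<close>

lemma integral_cond_exp:
  fixes f :: "real \<Rightarrow> real"
  assumes f [measurable]: "f \<in> borel_measurable unit_borel"
    and B: "\<And>v. v \<in> {0..1} \<Longrightarrow> \<bar>f v\<bar> \<le> B"
    and h [measurable]: "h \<in> borel_measurable S"
    and C: "\<And>s. s \<in> space S \<Longrightarrow> \<bar>h s\<bar> \<le> C"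
  shows "integrable (signal_law F Z) (\<lambda>s. h s * cond_exp_given_signal F Z f s)"
    and "(\<integral>s. h s * cond_exp_given_signal F Z f s \<partial>signal_law F Z) = (\<integral>y. h (snd y) * f (fst y) \<partial>J)"
proof -
  interpret sub: sigma_finite_subalgebra J "signal_algebra F Z"
    by (rule sigma_finite_subalgebra_signal)
  let ?c = "real_cond_exp J (signal_algebra F Z) (\<lambda>y. f (fst y))"
  have "\<bar>h s * f v\<bar> \<le> C * B" if "v \<in> {0..1}" "s \<in> space S" for v s
    using mult_mono[OF C[OF that(2)] B[OF that(1)]] C[OF that(2)] by (simp add: abs_mult)
  then have "integrable J (\<lambda>y. h (snd y) * f (fst y))"
    by (intro integrable_J[where B="C * B"]) auto
  note intg = sub.real_cond_exp_intg[OF this measurable_signal_algebra[OF h]]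
  have eq: "AE y in J. h (snd y) * cond_exp_given_signal F Z f (snd y) = h (snd y) * ?c y"
    using cond_exp_AE[of f] by eventually_elim simp
  have c: "?c \<in> borel_measurable J" by (rule borel_measurable_cond_exp2)
  have "integrable J (\<lambda>y. h (snd y) * cond_exp_given_signal F Z f (snd y))"
    by (subst integrable_cong_AE[OF _ _ eq]) (use c intg(1) in auto)
  then show "integrable (signal_law F Z) (\<lambda>s. h s * cond_exp_given_signal F Z f s)"
    unfolding signal_law_eq_distr by (subst integrable_distr_eq) auto
  have "(\<integral>s. h s * cond_exp_given_signal F Z f s \<partial>signal_law F Z)
      = (\<integral>y. h (snd y) * cond_exp_given_signal F Z f (snd y) \<partial>J)"
    unfolding signal_law_eq_distr by (subst integral_distr) auto
  also have "\<dots> = (\<integral>y. h (snd y) * ?c y \<partial>J)"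
    by (rule integral_cong_AE[OF _ _ eq]) (use c in auto)
  also have "\<dots> = (\<integral>y. h (snd y) * f (fst y) \<partial>J)"
    by (rule intg(2)) measurable
  finally show "(\<integral>s. h s * cond_exp_given_signal F Z f s \<partial>signal_law F Z)
      = (\<integral>y. h (snd y) * f (fst y) \<partial>J)" .
qed

lemma posterior_mean_unit: "AE s in signal_law F Z. posterior_mean F Z s \<in> {0..1}"
proof -
  interpret sub: sigma_finite_subalgebra J "signal_algebra F Z"
    by (rule sigma_finite_subalgebra_signal)
  have int: "integrable J fst" using integrable_fst[of "\<lambda>v. v" 1] ident_measurable_unit by auto
  have "AE y in J. real_cond_exp J (signal_algebra F Z) fst y \<ge> 0"
    using int by (intro sub.real_cond_exp_ge_c AE_I2) (auto simp: space_J)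
  moreover have "AE y in J. real_cond_exp J (signal_algebra F Z) fst y \<le> 1"
    using int by (intro sub.real_cond_exp_le_c AE_I2) (auto simp: space_J)
  ultimately have "AE y in J. posterior_mean F Z (snd y) \<in> {0..1}"
    using cond_exp_AE[of "\<lambda>v. v"] unfolding posterior_mean_def by eventually_elim simp
  then show ?thesis
    by (subst AE_signal_law_iff) auto
qed

text \<open>A function of the signal with the right integral over every signal event is a version of
  the conditional expectation. Since \<open>posterior_mean\<close> is obtained by a choice operator,
  this is how the posterior means of the deviation are identified, and only almost surely.\<close>

lemma posterior_mean_eqI:
  assumes g [measurable]: "g \<in> borel_measurable S"
    and B: "\<And>s. s \<in> space S \<Longrightarrow> \<bar>g s\<bar> \<le> B"
    and eq: "\<And>C. C \<in> sets S \<Longrightarrow> (\<integral>y. indicator C (snd y) * (fst y - g (snd y)) \<partial>J) = 0"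
  shows "AE y in J. posterior_mean F Z (snd y) = g (snd y)"
proof -
  interpret sub: sigma_finite_subalgebra J "signal_algebra F Z"
    by (rule sigma_finite_subalgebra_signal)
  have int: "integrable J fst" using integrable_fst[of "\<lambda>v. v" 1] ident_measurable_unit by auto
  have ig: "integrable J (\<lambda>y. g (snd y))" using B by (intro integrable_J[where B=B]) auto
  have "AE y in J. real_cond_exp J (signal_algebra F Z) fst y = g (snd y)"
  proof (rule sub.real_cond_exp_charact)
    fix A assume "A \<in> sets (signal_algebra F Z)"
    then obtain C where C [measurable]: "C \<in> sets S" "A = snd -` C \<inter> space J"
      by (rule sets_signal_algebraE)
    have set: "(LINT y:A|J. f y) = (\<integral>y. indicator C (snd y) * f y \<partial>J)" for f :: "_ \<Rightarrow> real"
      unfolding set_lebesgue_integral_def C(2)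
      by (intro Bochner_Integration.integral_cong) (auto simp: indicator_def)
    have ind: "integrable J (\<lambda>y. indicator C (snd y) * f y)" if "integrable J f" for f :: "_ \<Rightarrow> real"
    proof -
      have [measurable]: "f \<in> borel_measurable J" using that by auto
      show ?thesis by (rule Bochner_Integration.integrable_bound[OF that]) (auto simp: indicator_def)
    qed
    have "(\<integral>y. indicator C (snd y) * fst y \<partial>J) - (\<integral>y. indicator C (snd y) * g (snd y) \<partial>J) = 0"
      using eq[OF C(1)] ind[OF int] ind[OF ig] by (simp add: right_diff_distrib)
    then show "(LINT y:A|J. fst y) = (LINT y:A|J. g (snd y))" by (simp add: set)
  qed (use int ig measurable_signal_algebra[OF g] in auto)
  then show ?thesis
    using cond_exp_AE[of "\<lambda>v. v"] unfolding posterior_mean_def by eventually_elim simp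
qed

end

subsection \<open>Winning probabilities\<close>

text \<open>Agent i's chance of selection as a function of its posterior mean \<open>a\<close>. The
  product omits index i, so \<open>posterior_means\<close> is evaluated there at an unspecified
  signal; the update overwrites that coordinate.\<close>

definition win_prob ::
    "nat \<Rightarrow> nat \<Rightarrow> (nat \<Rightarrow> real measure) \<Rightarrow> (nat \<Rightarrow> 's scheme) \<Rightarrow> nat \<Rightarrow> real \<Rightarrow> real" where
  "win_prob N k F Z i a =
     (\<integral>\<sigma>. sel_prob N k ((posterior_means F Z \<sigma>)(i := a)) i
        \<partial>(\<Pi>\<^sub>M j\<in>{1..N} - {i}. signal_law (F j) (Z j)))"

text \<open>A deviation by i changes neither the rivals' law nor their coordinates. This is what
  reduces equilibrium to a one-agent problem against a fixed function of the posterior mean.\<close>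

lemma win_prob_fun_upd: "win_prob N k F (Z(i := Z')) i = win_prob N k F Z i"
proof
  fix a
  have "(\<Pi>\<^sub>M j\<in>{1..N} - {i}. signal_law (F j) ((Z(i := Z')) j))
      = (\<Pi>\<^sub>M j\<in>{1..N} - {i}. signal_law (F j) (Z j))"
    by (rule PiM_cong) auto
  moreover have "(posterior_means F (Z(i := Z')) \<sigma>)(i := a) = (posterior_means F Z \<sigma>)(i := a)" for \<sigma>
    by (auto simp: posterior_means_def fun_eq_iff)
  ultimately show "win_prob N k F (Z(i := Z')) i a = win_prob N k F Z i a"
    by (simp add: win_prob_def)
qed

locale selection_game =
  fixes N k :: nat and F :: "nat \<Rightarrow> real measure" and Z :: "nat \<Rightarrow> 's scheme"
  assumes k: "1 \<le> k" "k \<le> N"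
    and priors: "\<And>i. i \<in> {1..N} \<Longrightarrow> F i \<in> space (prob_algebra unit_borel)"
    and schemes: "\<And>i. i \<in> {1..N} \<Longrightarrow> signaling_scheme (Z i)"
begin

abbreviation "P \<equiv> profile_law N F Z"
abbreviation "law i \<equiv> signal_law (F i) (Z i)"
abbreviation "e \<equiv> posterior_means F Z"
abbreviation "w i \<equiv> win_prob N k F Z i"
abbreviation "rivals i \<equiv> Pi\<^sub>M ({1..N} - {i}) law"

lemma signaling: "i \<in> {1..N} \<Longrightarrow> signaling (F i) (Z i)"
  using priors schemes by unfold_locales

lemma prob_space_law: "i \<in> {1..N} \<Longrightarrow> prob_space (law i)"
  by (rule signaling.prob_space_signal_law[OF signaling])

lemma prob_space_P: "prob_space P"
  unfolding profile_law_def by (intro prob_space_PiM prob_space_law)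

lemma prob_space_rivals: "prob_space (rivals i)"
  by (intro prob_space_PiM prob_space_law) auto

lemma pm_measurable [measurable]:
  "i \<in> {1..N} \<Longrightarrow> posterior_mean (F i) (Z i) \<in> borel_measurable (law i)"
  using signaling.posterior_mean_measurable[OF signaling, of i]
    signaling.sets_signal_law[OF signaling, of i] by (simp cong: measurable_cong_sets)

lemma e_measurable:
  assumes "i \<in> I" "I \<subseteq> {1..N}"
  shows "(\<lambda>\<sigma>. e \<sigma> i) \<in> borel_measurable (Pi\<^sub>M I law)"
  unfolding posterior_means_def
proof -
  have "(\<lambda>\<sigma>. \<sigma> i) \<in> Pi\<^sub>M I law \<rightarrow>\<^sub>M law i"
    using assms by (intro measurable_component_singleton)
  moreover have "posterior_mean (F i) (Z i) \<in> borel_measurable (law i)"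
    using assms by (intro pm_measurable) auto
  ultimately show "(\<lambda>\<sigma>. posterior_mean (F i) (Z i) (\<sigma> i)) \<in> borel_measurable (Pi\<^sub>M I law)"
    by (rule measurable_compose)
qed

lemma e_measurable_P [measurable]: "i \<in> {1..N} \<Longrightarrow> (\<lambda>\<sigma>. e \<sigma> i) \<in> borel_measurable P"
  unfolding profile_law_def by (rule e_measurable) auto

lemma sel_measurable: "i \<in> {1..N} \<Longrightarrow> (\<lambda>\<sigma>. sel_prob N k (e \<sigma>) i) \<in> borel_measurable P"
  using borel_measurable_sel_prob[OF k, of i "\<lambda>j \<sigma>. e \<sigma> j" P] by simp

lemma sel_upd_measurable:
  assumes i: "i \<in> {1..N}"
  shows "(\<lambda>(a, \<sigma>). sel_prob N k ((e \<sigma>)(i := a)) i) \<in> borel_measurable (borel \<Otimes>\<^sub>M rivals i)"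
proof -
  have "(\<lambda>z. if j = i then fst z else e (snd z) j) \<in> borel_measurable (borel \<Otimes>\<^sub>M rivals i)"
    if "j \<in> {1..N}" for j
    using that by (cases "j = i") (auto intro!: measurable_compose[OF measurable_snd e_measurable])
  from borel_measurable_sel_prob[OF k i this]
  show ?thesis by (simp add: case_prod_beta fun_upd_def)
qed

lemma w_measurable: "i \<in> {1..N} \<Longrightarrow> w i \<in> borel_measurable borel"
proof -
  assume i: "i \<in> {1..N}"
  interpret prob_space "rivals i" by (rule prob_space_rivals)
  from borel_measurable_lebesgue_integral[OF sel_upd_measurable[OF i]]
  show ?thesis by (simp add: win_prob_def[abs_def])
qed

lemma sel_upd_integrable:
  assumes "i \<in> {1..N}"
  shows "integrable (rivals i) (\<lambda>\<sigma>. sel_prob N k ((e \<sigma>)(i := a)) i)"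
proof -
  interpret prob_space "rivals i" by (rule prob_space_rivals)
  have "(\<lambda>\<sigma>. sel_prob N k ((e \<sigma>)(i := a)) i) \<in> borel_measurable (rivals i)"
    using measurable_compose[OF measurable_Pair1'[of a borel] sel_upd_measurable[OF assms]] by simp
  then show ?thesis
    using sel_prob_bounds[OF k] by (intro integrable_const_bound[where B=1] AE_I2) auto
qed

lemma w_bounds: "i \<in> {1..N} \<Longrightarrow> 0 \<le> w i a" "i \<in> {1..N} \<Longrightarrow> w i a \<le> 1"
proof -
  assume i: "i \<in> {1..N}"
  interpret prob_space "rivals i" by (rule prob_space_rivals)
  show "0 \<le> w i a" unfolding win_prob_def by (simp add: sel_prob_bounds[OF k])
  show "w i a \<le> 1" unfolding win_prob_def
    by (rule integral_le_const[OF sel_upd_integrable[OF i]]) (simp add: sel_prob_bounds[OF k])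
qed

section \<open>Independence: integrating out the rivals of one agent\<close>

lemma insert_rival: "i \<in> {1..N} \<Longrightarrow> insert i ({1..N} - {i}) = {1..N}" by auto

lemma profile_law_split:
  assumes i: "i \<in> {1..N}"
  shows "P = distr (law i \<Otimes>\<^sub>M rivals i) P (\<lambda>(y, \<sigma>). \<sigma>(i := y))"
  using distr_pair_PiM_eq_PiM[of "{1..N} - {i}" law i, unfolded insert_rival[OF i]] i prob_space_law
  unfolding profile_law_def by simp

lemma upd_measurable:
  "i \<in> {1..N} \<Longrightarrow> (\<lambda>(y, \<sigma>). \<sigma>(i := y)) \<in> law i \<Otimes>\<^sub>M rivals i \<rightarrow>\<^sub>M P"
proof -
  assume i: "i \<in> {1..N}"
  have "(\<lambda>x. (snd x)(i := fst x)) \<in> law i \<Otimes>\<^sub>M rivals i \<rightarrow>\<^sub>M Pi\<^sub>M (insert i ({1..N} - {i})) law"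
    by (rule measurable_fun_upd[where J="{1..N} - {i}"]) auto
  then show ?thesis
    unfolding insert_rival[OF i] profile_law_def by (simp only: case_prod_beta')
qed

lemma e_upd: "e (\<sigma>(i := s)) = (e \<sigma>)(i := posterior_mean (F i) (Z i) s)"
  by (auto simp: posterior_means_def fun_eq_iff)

lemma integral_profile_law:
  fixes f :: "(nat \<Rightarrow> 's) \<Rightarrow> real"
  assumes i: "i \<in> {1..N}" and f: "integrable P f"
  shows "(\<integral>\<sigma>. f \<sigma> \<partial>P) = (\<integral>y. (\<integral>\<sigma>. f (\<sigma>(i := y)) \<partial>rivals i) \<partial>law i)"
proof -
  interpret A: prob_space "law i" using prob_space_law[OF i] .
  interpret B: prob_space "rivals i" using prob_space_rivals .
  interpret pair_sigma_finite "law i" "rivals i" ..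
  have [measurable]: "f \<in> borel_measurable P" using f by auto
  have "integrable (distr (law i \<Otimes>\<^sub>M rivals i) P (\<lambda>(y, \<sigma>). \<sigma>(i := y))) f"
    using f profile_law_split[OF i] by simp
  then have int: "integrable (law i \<Otimes>\<^sub>M rivals i) (\<lambda>z. f (case z of (y, \<sigma>) \<Rightarrow> \<sigma>(i := y)))"
    using upd_measurable[OF i] by (simp add: integrable_distr_eq)
  have "(\<integral>\<sigma>. f \<sigma> \<partial>P) = (\<integral>z. f (case z of (y, \<sigma>) \<Rightarrow> \<sigma>(i := y)) \<partial>(law i \<Otimes>\<^sub>M rivals i))"
    by (subst profile_law_split[OF i], subst integral_distr[OF upd_measurable[OF i]]) auto
  also have "\<dots> = (\<integral>y. (\<integral>\<sigma>. f (\<sigma>(i := y)) \<partial>rivals i) \<partial>law i)"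
    using integral_fst'[OF int] by simp
  finally show ?thesis .
qed

lemma integrable_component:
  fixes h :: "'s \<Rightarrow> real"
  assumes i: "i \<in> {1..N}" and h: "integrable (law i) h"
  shows "integrable P (\<lambda>\<sigma>. h (\<sigma> i))"
proof -
  have "distr P (law i) (\<lambda>\<sigma>. \<sigma> i) = law i"
    unfolding profile_law_def using i prob_space_law by (intro distr_PiM_component) auto
  with h have "integrable (distr P (law i) (\<lambda>\<sigma>. \<sigma> i)) h" by simp
  then show ?thesis
    by (rule integrable_distr[rotated])
      (unfold profile_law_def, rule measurable_component_singleton[OF i])
qed

lemma integrable_sel_mult:
  assumes i: "i \<in> {1..N}" and h: "integrable (law i) h"
  shows "integrable P (\<lambda>\<sigma>. sel_prob N k (e \<sigma>) i * h (\<sigma> i))"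
proof -
  note int = integrable_component[OF i h]
  then have "(\<lambda>\<sigma>. h (\<sigma> i)) \<in> borel_measurable P" by auto
  then show ?thesis
    using sel_measurable[OF i] sel_prob_bounds[OF k]
    by (intro Bochner_Integration.integrable_bound[OF int])
      (auto simp: abs_mult intro!: mult_left_le_one_le)
qed

text \<open>With i's own signal fixed, integrating over the rivals leaves \<open>h\<close> alone and
  turns the selection probability into \<open>w i\<close>. The lemma is applied with
  \<open>h\<close> the conditional utility, the posterior mean and the constant 1, giving utility,
  welfare and the total selection mass.\<close>

lemma integral_sel_mult:
  assumes i: "i \<in> {1..N}" and h: "integrable (law i) h"
  shows "(\<integral>\<sigma>. sel_prob N k (e \<sigma>) i * h (\<sigma> i) \<partial>P)
    = (\<integral>s. w i (posterior_mean (F i) (Z i) s) * h s \<partial>law i)"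
  by (subst integral_profile_law[OF i integrable_sel_mult[OF i h]])
    (simp add: e_upd win_prob_def mult.commute[of _ "h _"])

text \<open>The winning probability is a bounded function of the signal, so the conditional utility
  may be replaced by the utility of the value itself. In this form a scheme matters only through the
  joint law of value and posterior mean.\<close>

lemma expected_utility_eq:
  assumes i: "i \<in> {1..N}" and u: "u i \<in> borel_measurable unit_borel"
    and B: "\<And>v. v \<in> {0..1} \<Longrightarrow> \<bar>u i v\<bar> \<le> B"
  shows "expected_utility N k F u Z i
    = (\<integral>y. w i (posterior_mean (F i) (Z i) (snd y)) * u i (fst y) \<partial>joint_law (F i) (Z i))"
proof -
  interpret signaling "F i" "Z i" by (rule signaling[OF i])
  have "integrable (law i) (\<lambda>s. 1 * cond_exp_given_signal (F i) (Z i) (u i) s)"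
    by (rule integral_cond_exp[OF u B, where C=1]) auto
  then have "expected_utility N k F u Z i
      = (\<integral>s. w i (posterior_mean (F i) (Z i) s) * cond_exp_given_signal (F i) (Z i) (u i) s \<partial>law i)"
    unfolding expected_utility_def by (intro integral_sel_mult[OF i]) auto
  also have "\<dots> = (\<integral>y. w i (posterior_mean (F i) (Z i) (snd y)) * u i (fst y) \<partial>J)"
    using w_bounds[OF i] measurable_compose[OF posterior_mean_measurable w_measurable[OF i]]
    by (intro integral_cond_exp[OF u B, where C=1]) auto
  finally show ?thesis .
qed

lemma integrable_posterior_mean: "i \<in> {1..N} \<Longrightarrow> integrable (law i) (posterior_mean (F i) (Z i))"
proof -
  assume i: "i \<in> {1..N}"
  interpret prob_space "law i" by (rule prob_space_law[OF i])
  have "AE s in law i. norm (posterior_mean (F i) (Z i) s) \<le> 1"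
    using signaling.posterior_mean_unit[OF signaling[OF i]] by eventually_elim auto
  then show ?thesis by (rule integrable_const_bound) (rule pm_measurable[OF i])
qed

lemma integrable_sel_e: "i \<in> {1..N} \<Longrightarrow> integrable P (\<lambda>\<sigma>. sel_prob N k (e \<sigma>) i * e \<sigma> i)"
  using integrable_sel_mult[OF _ integrable_posterior_mean, of i] by (simp add: posterior_means_def)

lemma social_welfare_eq:
  "social_welfare N k F Z = (\<Sum>i\<in>{1..N}. \<integral>s. w i (posterior_mean (F i) (Z i) s) * posterior_mean (F i) (Z i) s \<partial>law i)"
proof -
  have "social_welfare N k F Z = (\<integral>\<sigma>. (\<Sum>i\<in>{1..N}. sel_prob N k (e \<sigma>) i * e \<sigma> i) \<partial>P)"
    unfolding social_welfare_def by (simp only: sum_kth_largest[OF k])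
  also have "\<dots> = (\<Sum>i\<in>{1..N}. \<integral>\<sigma>. sel_prob N k (e \<sigma>) i * e \<sigma> i \<partial>P)"
    by (rule Bochner_Integration.integral_sum) (rule integrable_sel_e)
  also have "\<dots> = (\<Sum>i\<in>{1..N}. \<integral>s. w i (posterior_mean (F i) (Z i) s) * posterior_mean (F i) (Z i) s \<partial>law i)"
    using integral_sel_mult[OF _ integrable_posterior_mean]
    by (intro sum.cong) (auto simp: posterior_means_def)
  finally show ?thesis .
qed

lemma sum_integral_w:
  "(\<Sum>i\<in>{1..N}. \<integral>s. w i (posterior_mean (F i) (Z i) s) \<partial>law i) = real k"
proof -
  interpret prob_space P by (rule prob_space_P)
  have int: "integrable (law i) (\<lambda>_. 1 :: real)" if "i \<in> {1..N}" for i
    using finite_measure.integrable_const[OF prob_space.finite_measure[OF prob_space_law[OF that]]] .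
  have "(\<Sum>i\<in>{1..N}. \<integral>s. w i (posterior_mean (F i) (Z i) s) \<partial>law i)
      = (\<Sum>i\<in>{1..N}. \<integral>\<sigma>. sel_prob N k (e \<sigma>) i \<partial>P)"
    using integral_sel_mult[OF _ int] by (intro sum.cong) auto
  also have "\<dots> = (\<integral>\<sigma>. (\<Sum>i\<in>{1..N}. sel_prob N k (e \<sigma>) i) \<partial>P)"
    using integrable_sel_mult[OF _ int]
    by (intro Bochner_Integration.integral_sum[symmetric]) auto
  also have "\<dots> = real k" by (simp only: sum_sel_prob[OF k]) (simp add: prob_space)
  finally show ?thesis .
qed

lemma AE_e_nonneg: "AE \<sigma> in P. \<forall>i\<in>{1..N}. 0 \<le> e \<sigma> i"
proof (rule AE_finite_allI)
  fix i assume i: "i \<in> {1..N}"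
  have "AE s in law i. 0 \<le> posterior_mean (F i) (Z i) s"
    using signaling.posterior_mean_unit[OF signaling[OF i]] by eventually_elim auto
  then show "AE \<sigma> in P. 0 \<le> e \<sigma> i"
    unfolding profile_law_def posterior_means_def using i prob_space_law
    by (intro AE_PiM_component) auto
qed simp

text \<open>Where the cutoff is at least x, all k units of selection mass fall on means at least x,
  so the welfare integrand is at least k x; elsewhere it is nonnegative. Comparing expectations
  bounds the probability of the first event by 1/2.\<close>

lemma prob_kth_largest_less:
  assumes x: "0 < x" "2 * social_welfare N k F Z \<le> real k * x"
  shows "1/2 \<le> measure P {\<sigma> \<in> space P. kth_largest N (e \<sigma>) k < x}"
proof -
  interpret prob_space P by (rule prob_space_P)
  have [measurable]: "(\<lambda>\<sigma>. kth_largest N (e \<sigma>) k) \<in> borel_measurable P"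
    using borel_measurable_kth_largest[OF k, of "\<lambda>j \<sigma>. e \<sigma> j" P] by simp
  let ?A = "{\<sigma> \<in> space P. x \<le> kth_largest N (e \<sigma>) k}"
  have A: "?A \<in> sets P" by measurable
  have int: "integrable P (\<lambda>\<sigma>. \<Sum>i\<in>{1..N}. sel_prob N k (e \<sigma>) i * e \<sigma> i)"
    by (intro Bochner_Integration.integrable_sum integrable_sel_e)
  have "AE \<sigma> in P. real k * x * indicator ?A \<sigma> \<le> (\<Sum>i\<in>{1..N}. sel_prob N k (e \<sigma>) i * e \<sigma> i)"
    using AE_e_nonneg
  proof eventually_elim
    case (elim \<sigma>)
    show ?case
    proof (cases "\<sigma> \<in> ?A")
      case True
      have "real k * x = (\<Sum>i\<in>{1..N}. sel_prob N k (e \<sigma>) i * x)"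
        by (simp only: sum_distrib_right[symmetric] sum_sel_prob[OF k])
      also have "\<dots> \<le> (\<Sum>i\<in>{1..N}. sel_prob N k (e \<sigma>) i * e \<sigma> i)"
      proof (rule sum_mono)
        fix i assume "i \<in> {1..N}"
        \<comment> \<open>A positive selection probability forces a mean at or above the
          cutoff.\<close>
        then have "sel_prob N k (e \<sigma>) i \<noteq> 0 \<Longrightarrow> x \<le> e \<sigma> i"
          using True by (auto simp: sel_prob_def Let_def split: if_splits)
        then show "sel_prob N k (e \<sigma>) i * x \<le> sel_prob N k (e \<sigma>) i * e \<sigma> i"
          using sel_prob_bounds(1)[OF k, of "e \<sigma>" i]
          by (cases "sel_prob N k (e \<sigma>) i = 0") (auto intro: mult_left_mono)
      qed
      finally show ?thesis using True by simp
    next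
      case False
      then show ?thesis
        using elim sel_prob_bounds(1)[OF k] by (auto intro!: sum_nonneg mult_nonneg_nonneg)
    qed
  qed
  then have "(\<integral>\<sigma>. real k * x * indicator ?A \<sigma> \<partial>P) \<le> social_welfare N k F Z"
    unfolding social_welfare_def sum_kth_largest[OF k]
    using A by (intro integral_mono_AE int) (auto simp: less_top[symmetric])
  then have "real k * x * measure P ?A \<le> social_welfare N k F Z"
    using A by simp
  then have "real k * x * (2 * measure P ?A) \<le> real k * x * 1" using x by simp
  then have "measure P ?A \<le> 1/2" using x k by simp
  moreover have "measure P {\<sigma> \<in> space P. kth_largest N (e \<sigma>) k < x} = 1 - measure P ?A"
  proof -
    have "{\<sigma> \<in> space P. kth_largest N (e \<sigma>) k < x} = space P - ?A" by auto
    then show ?thesis using prob_compl[OF A] by simp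
  qed
  ultimately show ?thesis by simp
qed

text \<open>On this event i wins for sure once its mean is replaced by \<open>a\<close>, by
  \<open>sel_prob_eq_1\<close>. The event refers to the full profile, while the replaced selection
  probability ignores i's own signal; its expectation over the full profile is therefore the rivals'
  integral defining \<open>w i a\<close>.\<close>

lemma w_ge:
  assumes i: "i \<in> {1..N}"
  shows "measure P {\<sigma> \<in> space P. kth_largest N (e \<sigma>) k < a} \<le> w i a"
proof -
  interpret prob_space P by (rule prob_space_P)
  interpret A: prob_space "law i" by (rule prob_space_law[OF i])
  have [measurable]: "(\<lambda>\<sigma>. kth_largest N (e \<sigma>) k) \<in> borel_measurable P"
    using borel_measurable_kth_largest[OF k, of "\<lambda>j \<sigma>. e \<sigma> j" P] by simp
  let ?A = "{\<sigma> \<in> space P. kth_largest N (e \<sigma>) k < a}"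
  have A: "?A \<in> sets P" by measurable
  have "(\<lambda>\<sigma>. if j = i then a else e \<sigma> j) \<in> borel_measurable P" if "j \<in> {1..N}" for j
    using that by auto
  from borel_measurable_sel_prob[OF k i this]
  have [measurable]: "(\<lambda>\<sigma>. sel_prob N k ((e \<sigma>)(i := a)) i) \<in> borel_measurable P"
    by (simp add: fun_upd_def)
  have int: "integrable P (\<lambda>\<sigma>. sel_prob N k ((e \<sigma>)(i := a)) i)"
    using sel_prob_bounds[OF k] by (intro integrable_const_bound[where B=1] AE_I2) auto
  have "measure P ?A = (\<integral>\<sigma>. indicator ?A \<sigma> \<partial>P)" using A by simp
  also have "\<dots> \<le> (\<integral>\<sigma>. sel_prob N k ((e \<sigma>)(i := a)) i \<partial>P)"
    using sel_prob_bounds[OF k] sel_prob_eq_1[OF k i]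
    by (intro integral_mono' int) (auto simp: indicator_def)
  also have "\<dots> = (\<integral>y. (\<integral>\<sigma>. sel_prob N k ((e (\<sigma>(i := y)))(i := a)) i \<partial>rivals i) \<partial>law i)"
    by (rule integral_profile_law[OF i int])
  also have "\<dots> = w i a"
    by (simp add: e_upd win_prob_def A.prob_space)
  finally show ?thesis .
qed

end

subsection \<open>Threshold deviations\<close>

text \<open>A randomized test as in the Neyman-Pearson lemma: the probability that the value v
  enters the pool. The parameter \<alpha> acts only at v = t, where the prior may have an
  atom.\<close>

definition threshold_weight :: "real \<Rightarrow> real \<Rightarrow> real \<Rightarrow> real" where
  "threshold_weight t \<alpha> v = (if t < v then 1 else if v = t then \<alpha> else 0)"

lemma threshold_weight_measurable [measurable]: "threshold_weight t \<alpha> \<in> borel_measurable borel"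
  unfolding threshold_weight_def[abs_def] by measurable

lemma threshold_weight_bounds:
  "0 \<le> \<alpha> \<Longrightarrow> \<alpha> \<le> 1 \<Longrightarrow> 0 \<le> threshold_weight t \<alpha> v"
  "0 \<le> \<alpha> \<Longrightarrow> \<alpha> \<le> 1 \<Longrightarrow> threshold_weight t \<alpha> v \<le> 1"
  by (auto simp: threshold_weight_def)

context signaling
begin

lemma fst_measurable [measurable]: "fst \<in> borel_measurable J"
  using measurable_compose[OF measurable_fst ident_measurable_unit, of S]
  by (simp cong: measurable_cong_sets)

text \<open>Under a bounded test of the signal the value may be exchanged for its posterior mean.
  The version \<open>e\<close> is left free, so that one with values in [0,1] everywhere can be
  used.\<close>

lemma integral_posterior:
  assumes e [measurable]: "e \<in> borel_measurable S" and eq: "AE y in J. posterior_mean F Z (snd y) = e (snd y)"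
    and h [measurable]: "h \<in> borel_measurable S" and C: "\<And>s. s \<in> space S \<Longrightarrow> \<bar>h s\<bar> \<le> C"
  shows "(\<integral>y. h (snd y) * fst y \<partial>J) = (\<integral>y. h (snd y) * e (snd y) \<partial>J)"
proof -
  have "(\<integral>y. h (snd y) * fst y \<partial>J) = (\<integral>s. h s * posterior_mean F Z s \<partial>signal_law F Z)"
    using integral_cond_exp(2)[of "\<lambda>v. v" 1, OF _ _ h C] by (simp add: posterior_mean_def)
  also have "\<dots> = (\<integral>y. h (snd y) * posterior_mean F Z (snd y) \<partial>J)"
    unfolding signal_law_eq_distr by (subst integral_distr) auto
  also have "\<dots> = (\<integral>y. h (snd y) * e (snd y) \<partial>J)"
    using eq by (intro integral_cong_AE) auto
  finally show ?thesis .
qed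

text \<open>The deviation leaves alone every signal whose posterior mean is outside \<open>L\<close>, reporting that
  mean, and replaces all others by the message \<open>2\<close> with probability \<open>threshold_weight t \<alpha> v\<close> and
  by the message \<open>3\<close> otherwise; no posterior mean is mistaken for these two numbers.\<close>

lemma threshold_deviation_law:
  fixes code :: "real \<Rightarrow> 's" and e :: "'s \<Rightarrow> real"
  assumes code: "inj code" and e [measurable]: "e \<in> borel_measurable S"
    and L [measurable]: "L \<in> sets borel" and \<alpha>: "0 \<le> \<alpha>" "\<alpha> \<le> 1"
  obtains Z' :: "'s scheme" and dec where "signaling_scheme Z'" "dec \<in> borel_measurable (sigspace Z')"
    "\<forall>C\<in>sets (sigspace Z').
       \<exists>D\<in>sets borel. \<forall>s\<in>space (sigspace Z'). s \<in> C \<longleftrightarrow> dec s \<in> D"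
    "\<forall>h B. h \<in> borel_measurable (unit_borel \<Otimes>\<^sub>M borel) \<longrightarrow>
       (\<forall>v\<in>{0..1}. \<forall>y. \<bar>h (v, y)\<bar> \<le> (B :: real)) \<longrightarrow>
       (\<integral>y. h (fst y, dec (snd y)) \<partial>joint_law F Z')
       = (\<integral>y. (if e (snd y) \<in> L then threshold_weight t \<alpha> (fst y) * h (fst y, 2)
                 + (1 - threshold_weight t \<alpha> (fst y)) * h (fst y, 3)
               else h (fst y, e (snd y))) \<partial>J)"
proof -
  define dec where "dec = inv code"
  \<comment> \<open>With the sigma-algebra pulled back along \<open>dec\<close>, signal events are
    exactly Borel conditions on the encoded number, and \<open>code\<close> is measurable.\<close>
  define S' where "S' = vimage_algebra (range code) dec borel"
  \<comment> \<open>The argument \<open>b\<close> is a coin with success probability \<alpha>; it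
    decides only at v = t.\<close>
  define \<phi> where "\<phi> v s b = (if e s \<in> L then if t < v \<or> v = t \<and> b then 2 else 3 else e s :: real)" for v s b
  define U where "U = measure_pmf (bernoulli_pmf \<alpha>)"
  define Z' where "Z' = \<lparr>sigspace = S', kern = \<lambda>v. kern Z v \<bind> (\<lambda>s. U \<bind> (\<lambda>b. return S' (code (\<phi> v s b))))\<rparr>"
  have dec_code [simp]: "dec (code y) = y" for y using code by (simp add: dec_def)
  have [measurable]: "dec \<in> borel_measurable S'"
    unfolding S'_def by (rule measurable_vimage_algebra1) simp
  have code_meas [measurable]: "code \<in> borel \<rightarrow>\<^sub>M S'"
    unfolding S'_def by (rule measurable_vimage_algebra2) auto
  have sets_U [measurable_cong]: "sets U = sets (count_space UNIV)" by (simp add: U_def)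
  have U_prob: "U \<in> space (prob_algebra (count_space UNIV))"
    by (simp add: space_prob_algebra U_def measure_pmf.prob_space_axioms)
  have \<phi>1: "(\<lambda>z. \<phi> (fst (fst z)) (snd (fst z)) (snd z))
      \<in> borel_measurable ((unit_borel \<Otimes>\<^sub>M S) \<Otimes>\<^sub>M count_space UNIV)"
    unfolding \<phi>_def by measurable
  have ret: "(\<lambda>z. return S' (code (\<phi> (fst (fst z)) (snd (fst z)) (snd z))))
      \<in> (unit_borel \<Otimes>\<^sub>M S) \<Otimes>\<^sub>M count_space UNIV \<rightarrow>\<^sub>M prob_algebra S'"
    using measurable_compose[OF measurable_compose[OF \<phi>1 code_meas] measurable_return_prob_space] .
  have K: "(\<lambda>z. U \<bind> (\<lambda>b. return S' (code (\<phi> (fst z) (snd z) b)))) \<in> unit_borel \<Otimes>\<^sub>M S \<rightarrow>\<^sub>M prob_algebra S'"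
    using U_prob ret
    by (intro measurable_bind_prob_space2[where N="count_space UNIV"] measurable_const)
      (simp_all add: case_prod_beta')
  have Z': "signaling_scheme Z'"
    unfolding signaling_scheme_def Z'_def using K
    by (auto intro!: measurable_bind_prob_space2[OF kern_measurable] simp: case_prod_beta')
  interpret Z': signaling F Z' using prior Z' by unfold_locales
  have S'_eq: "sigspace Z' = S'" by (simp add: Z'_def)
  interpret J: prob_space J by (rule prob_space_J)
  interpret U: prob_space U unfolding U_def by (rule measure_pmf.prob_space_axioms)
  interpret JU: pair_sigma_finite J U ..
  \<comment> \<open>A coupling: value, original signal and coin live on one product space, and the
    deviation's joint law is an image of it. Integrals under the deviation then follow by change of
    variables and averaging over the coin.\<close>
  define \<Psi> where "\<Psi> z = (fst (fst z), code (\<phi> (fst (fst z)) (snd (fst z)) (snd z)))" for z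
  have \<Psi> [measurable]: "\<Psi> \<in> J \<Otimes>\<^sub>M U \<rightarrow>\<^sub>M unit_borel \<Otimes>\<^sub>M S'"
    unfolding \<Psi>_def using measurable_compose[OF \<phi>1 code_meas] by measurable
  have J': "joint_law F Z' = distr (J \<Otimes>\<^sub>M U) (unit_borel \<Otimes>\<^sub>M S') \<Psi>"
  proof (rule measure_eqI)
    fix A assume "A \<in> sets (joint_law F Z')"
    then have A [measurable]: "A \<in> sets (unit_borel \<Otimes>\<^sub>M S')" by (simp add: S'_eq)
    have "emeasure (joint_law F Z') A = (\<integral>\<^sup>+z. indicator A z \<partial>joint_law F Z')"
      using A by (simp add: S'_eq)
    also have "\<dots> = (\<integral>\<^sup>+v. \<integral>\<^sup>+s. indicator A (v, s) \<partial>kern Z' v \<partial>F)"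
      by (rule Z'.nn_integral_joint_law) (simp add: S'_eq)
    also have "\<dots> = (\<integral>\<^sup>+v. \<integral>\<^sup>+s. \<integral>\<^sup>+b. indicator A (\<Psi> ((v, s), b)) \<partial>U \<partial>kern Z v \<partial>F)"
    proof (rule nn_integral_cong)
      fix v assume "v \<in> space F"
      then have v: "v \<in> {0..1}" "v \<in> space unit_borel" by (simp_all add: space_restrict_space)
      note [measurable_cong] = sets_kern[OF v(1)]
      have Av [measurable]: "(\<lambda>s. indicator A (v, s) :: ennreal) \<in> borel_measurable S'"
        using v by measurable
      have 1: "(\<lambda>s. U \<bind> (\<lambda>b. return S' (code (\<phi> v s b)))) \<in> kern Z v \<rightarrow>\<^sub>M subprob_algebra S'"
        using measurable_prob_algebraD[OF measurable_compose[OF measurable_Pair1'[OF v(2)] K]]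
        by (simp cong: measurable_cong_sets add: sets_kern[OF v(1)])
      have "(\<integral>\<^sup>+s. indicator A (v, s) \<partial>kern Z' v)
          = (\<integral>\<^sup>+s. \<integral>\<^sup>+y. indicator A (v, y) \<partial>(U \<bind> (\<lambda>b. return S' (code (\<phi> v s b)))) \<partial>kern Z v)"
        unfolding Z'_def by (simp add: nn_integral_bind[OF Av 1])
      also have "\<dots> = (\<integral>\<^sup>+s. \<integral>\<^sup>+b. indicator A (\<Psi> ((v, s), b)) \<partial>U \<partial>kern Z v)"
      proof (rule nn_integral_cong)
        fix s
        have 2: "(\<lambda>b. return S' (code (\<phi> v s b))) \<in> U \<rightarrow>\<^sub>M subprob_algebra S'"
          using measurable_space[OF code_meas]
          by (auto simp: measurable_def space_subprob_algebra U_def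
              intro!: prob_space_imp_subprob_space prob_space_return)
        show "(\<integral>\<^sup>+y. indicator A (v, y) \<partial>(U \<bind> (\<lambda>b. return S' (code (\<phi> v s b)))))
            = (\<integral>\<^sup>+b. indicator A (\<Psi> ((v, s), b)) \<partial>U)"
          using measurable_space[OF code_meas]
          by (simp add: nn_integral_bind[OF Av 2] nn_integral_return[OF _ Av] \<Psi>_def)
      qed
      finally show "(\<integral>\<^sup>+s. indicator A (v, s) \<partial>kern Z' v)
          = (\<integral>\<^sup>+s. \<integral>\<^sup>+b. indicator A (\<Psi> ((v, s), b)) \<partial>U \<partial>kern Z v)" .
    qed
    also have "\<dots> = (\<integral>\<^sup>+y. \<integral>\<^sup>+b. indicator A (\<Psi> (y, b)) \<partial>U \<partial>J)"
    proof (rule nn_integral_joint_law[symmetric])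
      have "(\<lambda>y. \<integral>\<^sup>+b. indicator A (\<Psi> (y, b)) \<partial>U) \<in> borel_measurable J" by measurable
      then show "(\<lambda>y. \<integral>\<^sup>+b. indicator A (\<Psi> (y, b)) \<partial>U) \<in> borel_measurable (unit_borel \<Otimes>\<^sub>M S)"
        by (simp cong: measurable_cong_sets)
    qed
    also have "\<dots> = (\<integral>\<^sup>+z. indicator A (\<Psi> z) \<partial>(J \<Otimes>\<^sub>M U))"
      by (subst U.nn_integral_fst) auto
    also have "\<dots> = emeasure (distr (J \<Otimes>\<^sub>M U) (unit_borel \<Otimes>\<^sub>M S') \<Psi>) A"
      by (subst nn_integral_indicator[symmetric], simp, subst nn_integral_distr) auto
    finally show "emeasure (joint_law F Z') A = emeasure (distr (J \<Otimes>\<^sub>M U) (unit_borel \<Otimes>\<^sub>M S') \<Psi>) A" .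
  qed (simp add: S'_eq)
  show thesis
  proof (rule that[OF Z', of dec])
    show "dec \<in> borel_measurable (sigspace Z')" by (simp add: S'_eq)
    show "\<forall>C\<in>sets (sigspace Z').
        \<exists>D\<in>sets borel. \<forall>s\<in>space (sigspace Z'). s \<in> C \<longleftrightarrow> dec s \<in> D"
      unfolding S'_eq S'_def by (subst sets_vimage_algebra2) auto
  next
    show "\<forall>h B. h \<in> borel_measurable (unit_borel \<Otimes>\<^sub>M borel) \<longrightarrow>
       (\<forall>v\<in>{0..1}. \<forall>y. \<bar>h (v, y)\<bar> \<le> (B :: real)) \<longrightarrow>
       (\<integral>y. h (fst y, dec (snd y)) \<partial>joint_law F Z')
       = (\<integral>y. (if e (snd y) \<in> L then threshold_weight t \<alpha> (fst y) * h (fst y, 2)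
                 + (1 - threshold_weight t \<alpha> (fst y)) * h (fst y, 3)
               else h (fst y, e (snd y))) \<partial>J)"
    proof (intro allI impI)
      fix h :: "real \<times> real \<Rightarrow> real" and B
      assume h [measurable]: "h \<in> borel_measurable (unit_borel \<Otimes>\<^sub>M borel)"
        and B: "\<forall>v\<in>{0..1}. \<forall>y. \<bar>h (v, y)\<bar> \<le> B"
      have "(\<lambda>y. (fst y, dec (snd y))) \<in> unit_borel \<Otimes>\<^sub>M S' \<rightarrow>\<^sub>M unit_borel \<Otimes>\<^sub>M borel" by measurable
      then have [measurable]: "(\<lambda>y. h (fst y, dec (snd y))) \<in> borel_measurable (unit_borel \<Otimes>\<^sub>M S')"
        by measurable
      have m: "(\<lambda>z. h (fst (\<Psi> z), dec (snd (\<Psi> z)))) \<in> borel_measurable (J \<Otimes>\<^sub>M U)"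
        using measurable_compose[OF \<Psi>, of "\<lambda>y. h (fst y, dec (snd y))"] by simp
      interpret JU': pair_prob_space J U ..
      have int: "integrable (J \<Otimes>\<^sub>M U) (\<lambda>z. h (fst (\<Psi> z), dec (snd (\<Psi> z))))"
        using m B by (intro JU'.P.integrable_const_bound[where B=B] AE_I2)
          (auto simp: space_pair_measure space_J \<Psi>_def)
      have "(\<integral>y. h (fst y, dec (snd y)) \<partial>joint_law F Z') = (\<integral>z. h (fst (\<Psi> z), dec (snd (\<Psi> z))) \<partial>(J \<Otimes>\<^sub>M U))"
        unfolding J' by (subst integral_distr) auto
      also have "\<dots> = (\<integral>y. (\<integral>b. h (fst (\<Psi> (y, b)), dec (snd (\<Psi> (y, b)))) \<partial>U) \<partial>J)"
        using JU.integral_fst'[OF int] by simp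
      also have "\<dots> = (\<integral>y. (if e (snd y) \<in> L then threshold_weight t \<alpha> (fst y) * h (fst y, 2)
                   + (1 - threshold_weight t \<alpha> (fst y)) * h (fst y, 3)
                 else h (fst y, e (snd y))) \<partial>J)"
      proof (rule Bochner_Integration.integral_cong[OF refl])
        fix y
        show "(\<integral>b. h (fst (\<Psi> (y, b)), dec (snd (\<Psi> (y, b)))) \<partial>U)
            = (if e (snd y) \<in> L then threshold_weight t \<alpha> (fst y) * h (fst y, 2)
                   + (1 - threshold_weight t \<alpha> (fst y)) * h (fst y, 3)
                 else h (fst y, e (snd y)))"
          unfolding U_def using \<alpha>
          by (simp add: \<Psi>_def \<phi>_def threshold_weight_def algebra_simps)
      qed
      finally show "(\<integral>y. h (fst y, dec (snd y)) \<partial>joint_law F Z')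
         = (\<integral>y. (if e (snd y) \<in> L then threshold_weight t \<alpha> (fst y) * h (fst y, 2)
                   + (1 - threshold_weight t \<alpha> (fst y)) * h (fst y, 3)
                 else h (fst y, e (snd y))) \<partial>J)" .
    qed
  qed
qed

text \<open>Message 2 has posterior mean x by \<open>balance\<close>, and every kept number is still
  its own posterior mean. Message 3 has some mean about which nothing is claimed; its utility is
  nonnegative and is dropped, whence an inequality.\<close>

lemma threshold_deviation:
  fixes code :: "real \<Rightarrow> 's" and e :: "'s \<Rightarrow> real"
  assumes code: "inj code" and e [measurable]: "e \<in> borel_measurable S"
    and e01: "\<And>s. s \<in> space S \<Longrightarrow> e s \<in> {0..1}"
    and eq: "AE y in J. posterior_mean F Z (snd y) = e (snd y)"
    and L [measurable]: "L \<in> sets borel" and \<alpha>: "0 \<le> \<alpha>" "\<alpha> \<le> 1"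
    and balance: "(\<integral>y. indicator L (e (snd y)) * threshold_weight t \<alpha> (fst y) * (fst y - x) \<partial>J) = 0"
    and R [measurable]: "R \<in> borel_measurable borel" and R01: "\<And>a. 0 \<le> R a" "\<And>a. R a \<le> 1"
    and u [measurable]: "u \<in> borel_measurable unit_borel"
    and u0: "\<And>v. v \<in> {0..1} \<Longrightarrow> 0 \<le> u v" and uB: "\<And>v. v \<in> {0..1} \<Longrightarrow> u v \<le> B"
  obtains Z' :: "'s scheme" where "signaling_scheme Z'"
    "(\<integral>y. (if e (snd y) \<in> L then threshold_weight t \<alpha> (fst y) * R x else R (e (snd y))) * u (fst y) \<partial>J)
      \<le> (\<integral>y. R (posterior_mean F Z' (snd y)) * u (fst y) \<partial>joint_law F Z')"
proof -
  let ?wt = "threshold_weight t \<alpha>"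
  obtain Z' :: "'s scheme" and dec where Z': "signaling_scheme Z'"
    and dec [measurable]: "dec \<in> borel_measurable (sigspace Z')"
    and sets: "\<forall>C\<in>sets (sigspace Z').
       \<exists>D\<in>sets borel. \<forall>s\<in>space (sigspace Z'). s \<in> C \<longleftrightarrow> dec s \<in> D"
    and "\<forall>h B. h \<in> borel_measurable (unit_borel \<Otimes>\<^sub>M borel) \<longrightarrow>
       (\<forall>v\<in>{0..1}. \<forall>y. \<bar>h (v, y)\<bar> \<le> (B :: real)) \<longrightarrow>
       (\<integral>y. h (fst y, dec (snd y)) \<partial>joint_law F Z')
       = (\<integral>y. (if e (snd y) \<in> L then ?wt (fst y) * h (fst y, 2) + (1 - ?wt (fst y)) * h (fst y, 3)
               else h (fst y, e (snd y))) \<partial>J)"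
    by (rule threshold_deviation_law[OF code e L \<alpha>, where t=t])
  then have law: "(\<integral>y. h (fst y, dec (snd y)) \<partial>joint_law F Z')
       = (\<integral>y. (if e (snd y) \<in> L then ?wt (fst y) * h (fst y, 2) + (1 - ?wt (fst y)) * h (fst y, 3)
               else h (fst y, e (snd y))) \<partial>J)"
    if "h \<in> borel_measurable (unit_borel \<Otimes>\<^sub>M borel)"
      "\<And>v y. v \<in> {0..1} \<Longrightarrow> \<bar>h (v, y)\<bar> \<le> B" for h :: "real \<times> real \<Rightarrow> real" and B
    using that by blast
  interpret Z': signaling F Z' using prior Z' by unfold_locales
  note wt = threshold_weight_bounds[OF \<alpha>, of t]
  define l where "l y = (indicator L (e (snd y)) :: real)" for y :: "real \<times> 's"
  have l: "0 \<le> l y" "l y \<le> 1" for y by (auto simp: l_def indicator_def)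
  have [measurable]: "l \<in> borel_measurable J" unfolding l_def by measurable
  \<comment> \<open>The mean of the low values left out of the pool. If these have mass zero the
    quotient is 0 by convention, and the next integral vanishes for any \<open>m\<close>.\<close>
  define m where "m = (\<integral>y. l y * (1 - ?wt (fst y)) * fst y \<partial>J) / (\<integral>y. l y * (1 - ?wt (fst y)) \<partial>J)"
  have int1: "integrable J (\<lambda>y. l y * (1 - ?wt (fst y)))"
    using l wt by (intro integrable_J[where B=1]) (auto simp: abs_mult intro!: mult_le_one)
  have int2: "integrable J (\<lambda>y. l y * (1 - ?wt (fst y)) * fst y)"
    using l wt by (intro integrable_J[where B=1]) (auto simp: abs_mult intro!: mult_le_one)
  have int3: "integrable J (\<lambda>y. l y * ?wt (fst y) * (fst y - x))"
  proof -
    have "integrable J (\<lambda>y. l y * ?wt (fst y) * fst y)" "integrable J (\<lambda>y. l y * ?wt (fst y))"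
      using l wt by (auto intro!: integrable_J[where B=1] mult_le_one simp: abs_mult)
    then show ?thesis by (simp add: right_diff_distrib)
  qed
  have m: "(\<integral>y. l y * (1 - ?wt (fst y)) * (fst y - m) \<partial>J) = 0"
  proof (cases "(\<integral>y. l y * (1 - ?wt (fst y)) \<partial>J) = 0")
    case True
    then have "AE y in J. l y * (1 - ?wt (fst y)) = 0"
      using integral_nonneg_eq_0_iff_AE[OF int1] l wt by auto
    then have "AE y in J. l y * (1 - ?wt (fst y)) * (fst y - m) = 0"
      by eventually_elim simp
    then show ?thesis by (rule integral_eq_zero_AE)
  next
    case False
    then show ?thesis using int1 int2 by (simp add: right_diff_distrib m_def)
  qed
  \<comment> \<open>The posterior mean belonging to each encoded number. Clamping changes nothing on
    [0,1] and keeps \<gamma> bounded on numbers that the deviation does not send.\<close>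
  define \<gamma> where "\<gamma> y = (if y = 2 then x else if y = 3 then m else max 0 (min 1 y))" for y :: real
  have [measurable]: "\<gamma> \<in> borel_measurable borel" unfolding \<gamma>_def by measurable
  have \<gamma>B: "\<bar>\<gamma> y\<bar> \<le> \<bar>x\<bar> + \<bar>m\<bar> + 1" for y by (auto simp: \<gamma>_def)
  have \<gamma>e: "\<gamma> (e s) = e s" if "s \<in> space S" for s
    using e01[OF that] by (auto simp: \<gamma>_def)
  have post: "AE y in joint_law F Z'. posterior_mean F Z' (snd y) = \<gamma> (dec (snd y))"
  proof (rule Z'.posterior_mean_eqI[where g="\<lambda>s. \<gamma> (dec s)"])
    fix C assume "C \<in> sets (sigspace Z')"
    then obtain D where D [measurable]: "D \<in> sets borel"
      and CD: "\<And>s. s \<in> space (sigspace Z') \<Longrightarrow> s \<in> C \<longleftrightarrow> dec s \<in> D"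
      using bspec[OF sets \<open>C \<in> sets (sigspace Z')\<close>] by blast
    let ?h = "\<lambda>z. indicator D (snd z) * (fst z - \<gamma> (snd z)) :: real"
    have "(\<integral>y. indicator C (snd y) * (fst y - \<gamma> (dec (snd y))) \<partial>joint_law F Z')
        = (\<integral>y. ?h (fst y, dec (snd y)) \<partial>joint_law F Z')"
      using CD by (intro Bochner_Integration.integral_cong) (auto simp: Z'.space_J indicator_def)
    also have "\<dots> = (\<integral>y. (if e (snd y) \<in> L then ?wt (fst y) * ?h (fst y, 2) + (1 - ?wt (fst y)) * ?h (fst y, 3)
               else ?h (fst y, e (snd y))) \<partial>J)"
    proof (rule law[where B="\<bar>x\<bar> + \<bar>m\<bar> + 2"])
      show "?h \<in> borel_measurable (unit_borel \<Otimes>\<^sub>M borel)"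
        using measurable_compose[OF measurable_fst ident_measurable_unit, of borel] by measurable
      show "\<bar>?h (v, y)\<bar> \<le> \<bar>x\<bar> + \<bar>m\<bar> + 2" if "v \<in> {0..1}" for v y
        using that \<gamma>B[of y] by (auto simp: indicator_def)
    qed
    \<comment> \<open>The test event splits into message 2, message 3 and the kept means. The three
      integrals vanish by \<open>balance\<close>, by the choice of \<open>m\<close>, and because
      \<open>e\<close> is a posterior mean under the original scheme.\<close>
    also have "\<dots> = (\<integral>y. indicator D 2 * (l y * ?wt (fst y) * (fst y - x))
        + (indicator D 3 * (l y * (1 - ?wt (fst y)) * (fst y - m))
        + indicator (D - L) (e (snd y)) * (fst y - e (snd y))) \<partial>J)"
      by (intro Bochner_Integration.integral_cong)
        (auto simp: l_def indicator_def space_J \<gamma>e, auto simp: \<gamma>_def)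
    also have "\<dots> = indicator D 2 * (\<integral>y. l y * ?wt (fst y) * (fst y - x) \<partial>J)
        + (indicator D 3 * (\<integral>y. l y * (1 - ?wt (fst y)) * (fst y - m) \<partial>J)
        + (\<integral>y. indicator (D - L) (e (snd y)) * (fst y - e (snd y)) \<partial>J))"
    proof -
      have a: "integrable J (\<lambda>y. l y * (1 - ?wt (fst y)) * (fst y - m))"
        using int1 int2 by (simp add: right_diff_distrib)
      have b: "integrable J (\<lambda>y. indicator (D - L) (e (snd y)) * (fst y - e (snd y)))"
        using e01 by (intro integrable_J[where B=1]) (force simp: indicator_def)+
      show ?thesis using int3 a b by simp
    qed
    also have "(\<integral>y. indicator (D - L) (e (snd y)) * (fst y - e (snd y)) \<partial>J) = 0"
    proof -
      have "integrable J (\<lambda>y. indicator (D - L) (e (snd y)) * fst y)"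
        by (intro integrable_J[where B=1]) (auto simp: indicator_def)
      moreover have "integrable J (\<lambda>y. indicator (D - L) (e (snd y)) * e (snd y))"
        using e01 by (intro integrable_J[where B=1]) (force simp: indicator_def)+
      moreover have "(\<integral>y. indicator (D - L) (e (snd y)) * fst y \<partial>J)
          = (\<integral>y. indicator (D - L) (e (snd y)) * e (snd y) \<partial>J)"
        by (rule integral_posterior[OF e eq, where C=1]) (auto simp: indicator_def)
      ultimately show ?thesis by (simp add: right_diff_distrib)
    qed
    finally show "(\<integral>y. indicator C (snd y) * (fst y - \<gamma> (dec (snd y))) \<partial>joint_law F Z') = 0"
      using m balance by (simp add: l_def)
  qed (use \<gamma>B in auto)
  let ?g = "\<lambda>z. R (\<gamma> (snd z)) * u (fst z)"
  have g: "?g \<in> borel_measurable (unit_borel \<Otimes>\<^sub>M borel)"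
    using measurable_compose[OF measurable_fst u, of borel] by measurable
  have RuB: "\<bar>R a * u v\<bar> \<le> B" if "v \<in> {0..1}" for a v
  proof -
    have "R a * u v \<le> 1 * u v" using R01 u0[OF that] by (intro mult_right_mono) auto
    then show ?thesis using R01 u0[OF that] uB[OF that] by (simp add: abs_mult)
  qed
  have RB: "\<bar>c * u v\<bar> \<le> B" if "v \<in> {0..1}" "0 \<le> c" "c \<le> 1" for c v
  proof -
    have "c * u v \<le> 1 * u v" using that u0[OF that(1)] by (intro mult_right_mono) auto
    then show ?thesis using that u0[OF that(1)] uB[OF that(1)] by (simp add: abs_mult)
  qed
  have um [measurable]: "(\<lambda>y. u (fst y)) \<in> borel_measurable J"
    using measurable_compose[OF measurable_fst u, of S] by (simp cong: measurable_cong_sets)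
  have um' [measurable]: "(\<lambda>y. u (fst y)) \<in> borel_measurable (joint_law F Z')"
    using measurable_compose[OF measurable_fst u, of "sigspace Z'"] by (simp cong: measurable_cong_sets)
  \<comment> \<open>Here the nonnegative contribution of message 3 is discarded.\<close>
  have "(\<integral>y. (if e (snd y) \<in> L then ?wt (fst y) * R x else R (e (snd y))) * u (fst y) \<partial>J)
      \<le> (\<integral>y. (if e (snd y) \<in> L then ?wt (fst y) * ?g (fst y, 2) + (1 - ?wt (fst y)) * ?g (fst y, 3)
               else ?g (fst y, e (snd y))) \<partial>J)"
  proof (rule integral_mono)
    show "integrable J (\<lambda>y. (if e (snd y) \<in> L then ?wt (fst y) * R x else R (e (snd y))) * u (fst y))"
      using R01 wt by (intro integrable_J[where B=B] RB) (auto intro!: mult_le_one)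
    have bound: "\<bar>(if e s \<in> L then ?wt v * ?g (v, 2) + (1 - ?wt v) * ?g (v, 3) else ?g (v, e s))\<bar> \<le> B"
      if "v \<in> {0..1}" for v s
    proof -
      have "?wt v * R (\<gamma> 2) + (1 - ?wt v) * R (\<gamma> 3) \<le> 1"
        using R01 wt by (intro convex_bound_le) auto
      then have "\<bar>(?wt v * R (\<gamma> 2) + (1 - ?wt v) * R (\<gamma> 3)) * u v\<bar> \<le> B"
        using that R01 wt by (intro RB) auto
      then show ?thesis using RuB[OF that, of "\<gamma> (e s)"] by (simp add: algebra_simps)
    qed
    have "(\<lambda>y. if e (snd y) \<in> L then ?wt (fst y) * ?g (fst y, 2) + (1 - ?wt (fst y)) * ?g (fst y, 3)
               else ?g (fst y, e (snd y))) \<in> borel_measurable J"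
      unfolding fst_conv snd_conv by measurable
    then show "integrable J (\<lambda>y. if e (snd y) \<in> L then ?wt (fst y) * ?g (fst y, 2) + (1 - ?wt (fst y)) * ?g (fst y, 3)
               else ?g (fst y, e (snd y)))"
    proof (rule integrable_J[where B=B])
      fix v s assume "v \<in> {0..1::real}"
      from bound[OF this, of s]
      show "\<bar>if e (snd (v, s)) \<in> L then ?wt (fst (v, s)) * ?g (fst (v, s), 2) + (1 - ?wt (fst (v, s))) * ?g (fst (v, s), 3)
               else ?g (fst (v, s), e (snd (v, s)))\<bar> \<le> B" by (simp only: fst_conv snd_conv)
    qed
    fix y assume "y \<in> space J"
    then have y: "fst y \<in> {0..1}" "snd y \<in> space S" by (auto simp: space_J)
    show "(if e (snd y) \<in> L then ?wt (fst y) * R x else R (e (snd y))) * u (fst y)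
      \<le> (if e (snd y) \<in> L then ?wt (fst y) * ?g (fst y, 2) + (1 - ?wt (fst y)) * ?g (fst y, 3)
               else ?g (fst y, e (snd y)))"
      using R01 wt u0[OF y(1)] \<gamma>e[OF y(2)] by (simp add: \<gamma>_def[of 2])
  qed
  also have "\<dots> = (\<integral>y. ?g (fst y, dec (snd y)) \<partial>joint_law F Z')"
    by (rule law[OF g, where B=B, symmetric]) (simp add: RuB)
  also have "\<dots> = (\<integral>y. R (posterior_mean F Z' (snd y)) * u (fst y) \<partial>joint_law F Z')"
    using post by (intro integral_cong_AE) auto
  finally show thesis using that Z' by blast
qed

text \<open>An intermediate value argument for the surplus \<open>G t\<close> of the values above t.
  It is nonnegative at t = x and equals the nonpositive total once t is below 0. It can jump at an
  atom of the weighted law; then \<alpha> admits the right fraction of that atom, whose surplus is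
  \<open>A t\<close>.\<close>

lemma threshold_exists:
  assumes l [measurable]: "l \<in> borel_measurable J" and l01: "\<And>y. 0 \<le> l y" "\<And>y. l y \<le> (1 :: real)"
    and x: "0 \<le> x" "x \<le> 1" and neg: "(\<integral>y. l y * (fst y - x) \<partial>J) \<le> 0"
  obtains t \<alpha> where "0 \<le> t" "t \<le> x" "0 \<le> \<alpha>" "\<alpha> \<le> 1"
    "(\<integral>y. l y * threshold_weight t \<alpha> (fst y) * (fst y - x) \<partial>J) = 0"
proof -
  define G where "G t = (\<integral>y. l y * indicator {t<..} (fst y) * (fst y - x) \<partial>J)" for t
  define A where "A t = (\<integral>y. l y * indicator {t} (fst y) * (fst y - x) \<partial>J)" for t
  interpret prob_space J by (rule prob_space_J)
  have bound: "\<bar>l y * c * (fst y - x)\<bar> \<le> 1" if "y \<in> space J" "0 \<le> c" "c \<le> 1" for y c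
    using that x l01[of y] by (auto simp: abs_mult space_J intro!: mult_le_one)
  have int: "integrable J (\<lambda>y. l y * indicator B (fst y) * (fst y - x))" if [measurable]: "B \<in> sets borel" for B
    using bound[of _ "indicator B _"]
    by (intro integrable_const_bound[where B=1] AE_I2) (auto simp: indicator_def)
  \<comment> \<open>Dominated convergence with bound 1, prepared for the limits at \<open>t\<close>
    from both sides.\<close>
  have lim: "(\<lambda>n. G (s n)) \<longlonglongrightarrow> (\<integral>y. l y * indicator B (fst y) * (fst y - x) \<partial>J)"
    if "\<And>v. eventually (\<lambda>n. indicator {s n<..} v = (indicator B v :: real)) sequentially"
      and [measurable]: "B \<in> sets borel" for s B
    unfolding G_def
  proof (rule integral_dominated_convergence[where w="\<lambda>_. 1"])
    show "AE y in J. (\<lambda>n. l y * indicator {s n<..} (fst y) * (fst y - x))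
        \<longlonglongrightarrow> l y * indicator B (fst y) * (fst y - x)"
    proof (rule AE_I2)
      fix y :: "real \<times> 's"
      show "(\<lambda>n. l y * indicator {s n<..} (fst y) * (fst y - x))
        \<longlonglongrightarrow> l y * indicator B (fst y) * (fst y - x)"
        by (rule tendsto_eventually) (rule eventually_mono[OF that(1)[of "fst y"]], simp)
    qed
    show "AE y in J. norm (l y * indicator {s n<..} (fst y) * (fst y - x)) \<le> 1" for n
      using bound[of _ "indicator {s n<..} _"] by (intro AE_I2) (auto simp: indicator_def)
  qed auto
  define D where "D = {t \<in> {0..x}. 0 \<le> G t}"
  have "0 \<le> G x"
    unfolding G_def using l01 by (intro Bochner_Integration.integral_nonneg) (auto simp: indicator_def)
  then have xD: "x \<in> D" using x by (simp add: D_def)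
  have bdd: "bdd_below D" by (rule bdd_belowI[of _ 0]) (simp add: D_def)
  define t where "t = Inf D"
  have t: "0 \<le> t" "t \<le> x"
    unfolding t_def using xD bdd by (auto intro!: cInf_greatest cInf_lower simp: D_def)
  have "t \<in> closure D" unfolding t_def using xD bdd by (intro closure_contains_Inf) auto
  then obtain s where s: "\<And>n. s n \<in> D" "s \<longlonglongrightarrow> t" unfolding closure_sequential by auto
  \<comment> \<open>Since \<open>t\<close> is a lower bound of \<open>D\<close>, the sequence
    approaches from above and its open rays converge to the open ray at \<open>t\<close>.\<close>
  have "(\<lambda>n. G (s n)) \<longlonglongrightarrow> G t"
    unfolding G_def[of t]
  proof (rule lim)
    fix v
    show "eventually (\<lambda>n. indicator {s n<..} v = (indicator {t<..} v :: real)) sequentially"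
    proof (cases "t < v")
      case True
      from order_tendstoD(2)[OF s(2) this] show ?thesis by eventually_elim (simp add: True)
    next
      case False
      have "t \<le> s n" for n unfolding t_def using s(1) bdd by (intro cInf_lower)
      then have "\<not> s n < v" for n using False by (auto simp: not_less intro: order_trans)
      then show ?thesis using False by simp
    qed
  qed simp
  then have Gt: "0 \<le> G t"
    using s(1) by (intro LIMSEQ_le_const[where x="G t"]) (auto simp: D_def)
  define s' where "s' n = t - inverse (real (Suc n))" for n
  have s': "s' n < t" for n by (simp add: s'_def)
  have "s' \<longlonglongrightarrow> t"
    unfolding s'_def using LIMSEQ_inverse_real_of_nat_add_minus[of t] by simp
  \<comment> \<open>From strictly below, the open rays converge to the closed ray, so the limit
    includes the atom at \<open>t\<close>.\<close>
  have "(\<lambda>n. G (s' n)) \<longlonglongrightarrow> (\<integral>y. l y * indicator {t..} (fst y) * (fst y - x) \<partial>J)"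
  proof (rule lim)
    fix v
    show "eventually (\<lambda>n. indicator {s' n<..} v = (indicator {t..} v :: real)) sequentially"
    proof (cases "v < t")
      case True
      from order_tendstoD(1)[OF \<open>s' \<longlonglongrightarrow> t\<close> this] show ?thesis
        by eventually_elim (use True in \<open>simp add: indicator_def\<close>)
    next
      case False
      then have "s' n < v" for n using s'[of n] by simp
      then show ?thesis using False by simp
    qed
  qed simp
  moreover have "G (s' n) \<le> 0" for n
  \<comment> \<open>For small \<open>t\<close> the sequence may leave [0,x]; below 0 the ray
    contains every value and \<open>neg\<close> applies.\<close>
  proof (cases "s' n < 0")
    case True
    then have "G (s' n) = (\<integral>y. l y * (fst y - x) \<partial>J)"
      unfolding G_def by (intro Bochner_Integration.integral_cong) (auto simp: space_J)
    then show ?thesis using neg by simp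
  next
    case False
    have "s' n \<notin> D" using s'[of n] cInf_lower[OF _ bdd, of "s' n"] unfolding t_def by auto
    then show ?thesis using False s'[of n] t by (auto simp: D_def)
  qed
  ultimately have "(\<integral>y. l y * indicator {t..} (fst y) * (fst y - x) \<partial>J) \<le> 0"
    by (intro LIMSEQ_le_const2) auto
  also have "(\<integral>y. l y * indicator {t..} (fst y) * (fst y - x) \<partial>J)
      = (\<integral>y. l y * indicator {t<..} (fst y) * (fst y - x) + l y * indicator {t} (fst y) * (fst y - x) \<partial>J)"
    by (intro Bochner_Integration.integral_cong) (auto simp: indicator_def)
  also have "\<dots> = G t + A t"
    unfolding G_def A_def by (rule Bochner_Integration.integral_add) (auto intro!: int)
  finally have GA: "G t + A t \<le> 0" .
  \<comment> \<open>If \<open>A t\<close> is 0, then \<open>Gt\<close> and \<open>GA\<close> force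
    \<open>G t\<close> to be 0 and \<alpha> = 0 works; otherwise \<open>A t\<close> is negative and
    the quotient lies in [0,1].\<close>
  define \<alpha> where "\<alpha> = (if A t = 0 then 0 else - G t / A t)"
  have \<alpha>: "0 \<le> \<alpha>" "\<alpha> \<le> 1" "G t + \<alpha> * A t = 0"
    using Gt GA by (auto simp: \<alpha>_def divide_simps)
  have "(\<integral>y. l y * threshold_weight t \<alpha> (fst y) * (fst y - x) \<partial>J)
      = (\<integral>y. l y * indicator {t<..} (fst y) * (fst y - x) + \<alpha> * (l y * indicator {t} (fst y) * (fst y - x)) \<partial>J)"
    by (intro Bochner_Integration.integral_cong) (auto simp: threshold_weight_def indicator_def)
  also have "\<dots> = G t + \<alpha> * A t"
    unfolding G_def A_def by (subst Bochner_Integration.integral_add) (auto intro!: int)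
  finally show thesis using that[OF t \<alpha>(1,2)] \<alpha>(3) by simp
qed

text \<open>The one-agent problem: \<open>R a\<close> is the chance of winning with posterior mean
  \<open>a\<close>, and \<open>nash\<close> says that the scheme is optimal against
  \<open>R\<close>. The first term on the right pays for the excess on low signals, the second for
  the excess on all others.\<close>

lemma equilibrium_bound:
  fixes code :: "real \<Rightarrow> 's" and u :: "real \<Rightarrow> real"
  assumes code: "inj code" and x: "0 < x"
    and R [measurable]: "R \<in> borel_measurable borel" and R01: "\<And>a. 0 \<le> R a" "\<And>a. R a \<le> 1"
    and Rx: "\<And>a. x \<le> a \<Longrightarrow> 1/2 \<le> R a"
    and u [measurable]: "u \<in> borel_measurable unit_borel" and mono: "mono_on {0..1} u"
    and u0: "\<And>v. v \<in> {0..1} \<Longrightarrow> 0 \<le> u v" and upos: "\<And>v. v \<in> {0<..1} \<Longrightarrow> 0 < u v"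
    and nash: "\<And>Z' :: 's scheme. signaling_scheme Z' \<Longrightarrow>
      (\<integral>y. R (posterior_mean F Z' (snd y)) * u (fst y) \<partial>joint_law F Z')
      \<le> (\<integral>y. R (posterior_mean F Z (snd y)) * u (fst y) \<partial>J)"
  shows "(\<integral>v. max 0 (v - x) \<partial>F) \<le> 4 * x * (\<integral>s. R (posterior_mean F Z s) \<partial>signal_law F Z)
      + 4 * (\<integral>s. R (posterior_mean F Z s) * posterior_mean F Z s \<partial>signal_law F Z)"
proof -
  \<comment> \<open>Clamping yields a version with values in [0,1] everywhere, so no kept mean
    coincides with the messages 2 and 3.\<close>
  define e where "e s = max 0 (min 1 (posterior_mean F Z s))" for s
  have e [measurable]: "e \<in> borel_measurable S" unfolding e_def by measurable
  have e01: "e s \<in> {0..1}" for s by (auto simp: e_def)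
  have eq: "AE y in J. posterior_mean F Z (snd y) = e (snd y)"
  proof -
    have "AE y in J. posterior_mean F Z (snd y) \<in> {0..1}"
      using posterior_mean_unit by (subst (asm) AE_signal_law_iff) auto
    then show ?thesis by eventually_elim (auto simp: e_def)
  qed
  define r where "r y = R (e (snd y))" for y :: "real \<times> 's"
  have r_meas [measurable]: "r \<in> borel_measurable J" unfolding r_def by measurable
  have r01: "0 \<le> r y" "r y \<le> 1" for y using R01 by (auto simp: r_def)
  define L where "L = {a. R a \<le> 1/4}"
  have L [measurable]: "L \<in> sets borel" unfolding L_def by measurable
  define l where "l y = (indicator L (e (snd y)) :: real)" for y :: "real \<times> 's"
  have l_meas [measurable]: "l \<in> borel_measurable J" unfolding l_def by measurable
  have l01: "0 \<le> l y" "l y \<le> 1" for y by (auto simp: l_def indicator_def)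
  \<comment> \<open>A mean at or above x wins with probability at least 1/2, hence is not
    low.\<close>
  have l_cases: "l y = 0 \<and> 1/4 < r y \<or> l y = 1 \<and> r y \<le> 1/4 \<and> e (snd y) < x" for y
    using Rx[of "e (snd y)"] by (fastforce simp: l_def r_def L_def indicator_def)
  have RHS: "(\<integral>s. R (posterior_mean F Z s) \<partial>signal_law F Z) = (\<integral>y. r y \<partial>J)"
    "(\<integral>s. R (posterior_mean F Z s) * posterior_mean F Z s \<partial>signal_law F Z) = (\<integral>y. r y * e (snd y) \<partial>J)"
    unfolding signal_law_eq_distr r_def
    by (subst integral_distr, simp, simp, rule integral_cong_AE, simp, simp,
        use eq in eventually_elim, simp)+
  have LHS: "(\<integral>v. max 0 (v - x) \<partial>F) = (\<integral>y. max 0 (fst y - x) \<partial>J)"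
    by (subst F_eq_distr, subst integral_distr) (auto cong: measurable_cong_sets)
  have int: "integrable J f" if "f \<in> borel_measurable J" "\<And>v s. v \<in> {0..1} \<Longrightarrow> s \<in> space S \<Longrightarrow> f (v, s) \<in> {0..1}"
    for f :: "real \<times> 's \<Rightarrow> real"
    using that(1) by (rule integrable_J[where B=1]) (use that(2) in fastforce)
  have int_r: "integrable J r" using r01 by (intro int) auto
  have int_re: "integrable J (\<lambda>y. r y * e (snd y))"
    using r01 e01 by (intro int) (auto intro!: mult_le_one)
  have re: "0 \<le> (\<integral>y. r y * e (snd y) \<partial>J)" "0 \<le> (\<integral>y. r y \<partial>J)"
    using r01 e01 by (auto intro!: Bochner_Integration.integral_nonneg)
  have low: "(\<integral>y. l y * max 0 (fst y - x) \<partial>J) \<le> 4 * x * (\<integral>y. r y \<partial>J)"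
  \<comment> \<open>For x > 1 no value exceeds x; the pooling argument is only for x in the unit
    interval.\<close>
  proof (cases "x \<le> 1")
    case False
    then have "(\<integral>y. l y * max 0 (fst y - x) \<partial>J) = (\<integral>y. 0 \<partial>J)"
      by (intro Bochner_Integration.integral_cong) (auto simp: space_J)
    then show ?thesis using x re(2) by simp
  next
    case True
    have int_lv: "integrable J (\<lambda>y. l y * fst y)" using l01 by (intro int) (auto intro!: mult_le_one)
    have int_l: "integrable J l" using l01 by (intro int) auto
    have int_le: "integrable J (\<lambda>y. l y * e (snd y))" using l01 e01 by (intro int) (auto intro!: mult_le_one)
    have "(\<integral>y. l y * (fst y - x) \<partial>J) = (\<integral>y. l y * fst y \<partial>J) - (\<integral>y. l y * x \<partial>J)"
      using int_lv int_l by (simp add: right_diff_distrib)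
    also have "(\<integral>y. l y * fst y \<partial>J) = (\<integral>y. l y * e (snd y) \<partial>J)"
      unfolding l_def by (rule integral_posterior[OF e eq, where C=1]) (auto simp: indicator_def)
    also have "(\<integral>y. l y * e (snd y) \<partial>J) \<le> (\<integral>y. l y * x \<partial>J)"
    proof (rule integral_mono[OF int_le])
      fix y show "l y * e (snd y) \<le> l y * x" using l_cases[of y] by auto
    qed (use int_l in simp)
    finally have "(\<integral>y. l y * (fst y - x) \<partial>J) \<le> 0" by simp
    then obtain t \<alpha> where t: "0 \<le> t" "t \<le> x" and \<alpha>: "0 \<le> \<alpha>" "\<alpha> \<le> 1"
      and balance: "(\<integral>y. l y * threshold_weight t \<alpha> (fst y) * (fst y - x) \<partial>J) = 0"
      using threshold_exists[OF l_meas l01, of x] x True by auto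
    note wt = threshold_weight_bounds[OF \<alpha>, of t]
    define w where "w y = threshold_weight t \<alpha> (fst y)" for y :: "real \<times> 's"
    have w01: "0 \<le> w y" "w y \<le> 1" for y using wt by (auto simp: w_def)
    have w_meas [measurable]: "w \<in> borel_measurable J" unfolding w_def by measurable
    have t1: "t \<in> {0..1}" using t True by auto
    have um [measurable]: "(\<lambda>y. u (fst y)) \<in> borel_measurable J"
      using measurable_compose[OF measurable_fst u, of S] by (simp cong: measurable_cong_sets)
    have uB: "u v \<le> u 1" if "v \<in> {0..1}" for v using that by (intro mono_onD[OF mono]) auto
    have int_u: "integrable J (\<lambda>y. f y * u (fst y))"
      if "f \<in> borel_measurable J" "\<And>y. 0 \<le> f y" "\<And>y. f y \<le> 1" for f :: "real \<times> 's \<Rightarrow> real"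
    proof (rule integrable_J[where B="u 1"])
      fix v s assume v: "v \<in> {0..1::real}"
      have "f (v, s) * u v \<le> 1 * u v" using that u0[OF v] by (intro mult_right_mono) auto
      then show "\<bar>f (v, s) * u (fst (v, s))\<bar> \<le> u 1"
        using that u0[OF v] uB[OF v] by (simp add: abs_mult)
    qed (use that in measurable)
    have lw: "integrable J (\<lambda>y. l y * w y * u (fst y))" "integrable J (\<lambda>y. l y * r y * u (fst y))"
      "integrable J (\<lambda>y. (1 - l y) * r y * u (fst y))" "integrable J (\<lambda>y. r y * u (fst y))"
      using l01 w01 r01 by (auto intro!: int_u mult_le_one)
    have int_lw: "integrable J (\<lambda>y. l y * w y)" and int_lr: "integrable J (\<lambda>y. l y * r y)"
      using l01 w01 r01 by (auto intro!: int mult_le_one)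
    \<comment> \<open>What the deviation secures: a pooled value wins with probability at least 1/2
      and all other signals keep their old winning probability.\<close>
    have "(\<integral>y. 1/2 * (l y * w y * u (fst y)) + (1 - l y) * r y * u (fst y) \<partial>J)
        \<le> (\<integral>y. (if e (snd y) \<in> L then threshold_weight t \<alpha> (fst y) * R x else R (e (snd y))) * u (fst y) \<partial>J)"
    proof (rule integral_mono)
      show "integrable J (\<lambda>y. 1/2 * (l y * w y * u (fst y)) + (1 - l y) * r y * u (fst y))"
        using lw by simp
      show "integrable J (\<lambda>y. (if e (snd y) \<in> L then threshold_weight t \<alpha> (fst y) * R x else R (e (snd y))) * u (fst y))"
        using R01 wt by (intro int_u) (auto intro!: mult_le_one)
      fix y assume "y \<in> space J"
      then have "fst y \<in> {0..1}" by (auto simp: space_J)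
      from u0[OF this] have "1/2 * (w y * u (fst y)) \<le> R x * (w y * u (fst y))"
        using Rx[of x] w01 by (intro mult_right_mono) auto
      then show "1/2 * (l y * w y * u (fst y)) + (1 - l y) * r y * u (fst y)
        \<le> (if e (snd y) \<in> L then threshold_weight t \<alpha> (fst y) * R x else R (e (snd y))) * u (fst y)"
        by (auto simp: l_def w_def r_def mult_ac)
    qed
    also have "\<dots> \<le> (\<integral>y. r y * u (fst y) \<partial>J)"
    proof -
      obtain Z' :: "'s scheme" where Z': "signaling_scheme Z'" and
        "(\<integral>y. (if e (snd y) \<in> L then threshold_weight t \<alpha> (fst y) * R x else R (e (snd y))) * u (fst y) \<partial>J)
        \<le> (\<integral>y. R (posterior_mean F Z' (snd y)) * u (fst y) \<partial>joint_law F Z')"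
        by (rule threshold_deviation[OF code e e01 eq L \<alpha> balance[unfolded l_def] R R01 u u0 uB])
      note this(2)
      also have "(\<integral>y. R (posterior_mean F Z' (snd y)) * u (fst y) \<partial>joint_law F Z')
          \<le> (\<integral>y. R (posterior_mean F Z (snd y)) * u (fst y) \<partial>J)"
        by (rule nash[OF Z'])
      also have "\<dots> = (\<integral>y. r y * u (fst y) \<partial>J)"
        unfolding r_def by (rule integral_cong_AE) (use eq in \<open>auto elim: eventually_mono\<close>)
      finally show ?thesis .
    qed
    also have "\<dots> = (\<integral>y. l y * r y * u (fst y) + (1 - l y) * r y * u (fst y) \<partial>J)"
      by (intro Bochner_Integration.integral_cong) (auto simp: algebra_simps)
    \<comment> \<open>The signals outside the pooling region contribute equally to both sides and
      cancel.\<close>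
    finally have gain: "1/2 * (\<integral>y. l y * w y * u (fst y) \<partial>J) \<le> (\<integral>y. l y * r y * u (fst y) \<partial>J)"
      using lw by simp
    \<comment> \<open>Above t a value is pooled for sure and currently wins with probability at most
      1/4; up to t its utility is at most u(t). Half of the gain then absorbs the quarter
      term.\<close>
    have "(\<integral>y. l y * r y * u (fst y) \<partial>J) \<le> (\<integral>y. l y * r y * u t + 1/4 * (l y * w y * u (fst y)) \<partial>J)"
    proof (rule integral_mono[OF lw(2)])
      show "integrable J (\<lambda>y. l y * r y * u t + 1/4 * (l y * w y * u (fst y)))"
        using int_lr lw by simp
      fix y assume "y \<in> space J"
      then have y: "fst y \<in> {0..1}" by (auto simp: space_J)
      show "l y * r y * u (fst y) \<le> l y * r y * u t + 1/4 * (l y * w y * u (fst y))"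
      proof (cases "t < fst y")
        case True
        then have "w y = 1" by (simp add: w_def threshold_weight_def)
        moreover have "l y * (r y * u (fst y)) \<le> l y * (1/4 * u (fst y))"
          using l_cases[of y] mult_right_mono[OF _ u0[OF y], of "r y" "1/4"] by auto
        moreover have "0 \<le> l y * r y * u t" using l01 r01 u0[OF t1] by simp
        ultimately show ?thesis by (simp add: mult_ac)
      next
        case False
        then have "u (fst y) \<le> u t" using y t1 by (intro mono_onD[OF mono]) auto
        then have "l y * r y * u (fst y) \<le> l y * r y * u t"
          using l01 r01 by (intro mult_left_mono) auto
        moreover have "0 \<le> l y * w y * u (fst y)" using l01 w01 u0[OF y] by simp
        ultimately show ?thesis by simp
      qed
    qed
    also have "\<dots> = u t * (\<integral>y. l y * r y \<partial>J) + 1/4 * (\<integral>y. l y * w y * u (fst y) \<partial>J)"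
      using int_lr lw by (simp add: mult.commute)
    finally have lwu: "1/4 * (\<integral>y. l y * w y * u (fst y) \<partial>J) \<le> u t * (\<integral>y. l y * r y \<partial>J)"
      using gain by simp
    show ?thesis
    \<comment> \<open>The factor u(t) cannot be cancelled if it is 0. Then t = 0, so every positive
      value is pooled, and the bound makes the pooled utility vanish; as u is positive at values
      above x, low signals almost surely carry no such value.\<close>
    proof (cases "u t = 0")
      case True
      with upos[of t] t1 have "t = 0" by force
      have nn: "0 \<le> l y * w y * u (fst y)" if "y \<in> space J" for y
        using that l01 w01 u0 by (auto simp: space_J)
      have "0 \<le> (\<integral>y. l y * w y * u (fst y) \<partial>J)"
        by (rule Bochner_Integration.integral_nonneg) (rule nn)
      then have "(\<integral>y. l y * w y * u (fst y) \<partial>J) = 0" using lwu True by simp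
      then have "AE y in J. l y * w y * u (fst y) = 0"
        using integral_nonneg_eq_0_iff_AE[OF lw(1)] nn by (auto simp: AE_I2)
      then have "AE y in J. l y * max 0 (fst y - x) = 0"
      proof (rule AE_mp, intro AE_I2 impI)
        fix y assume y: "y \<in> space J" and *: "l y * w y * u (fst y) = 0"
        show "l y * max 0 (fst y - x) = 0"
        proof (cases "x < fst y")
          case True
          then have "0 < u (fst y)" "w y = 1"
            using upos[of "fst y"] x y \<open>t = 0\<close> by (auto simp: space_J w_def threshold_weight_def)
          then show ?thesis using * by simp
        qed simp
      qed
      then have "(\<integral>y. l y * max 0 (fst y - x) \<partial>J) = 0" by (rule integral_eq_zero_AE)
      then show ?thesis using x re(2) by simp
    next
      case False
      then have ut: "0 < u t" using u0[OF t1] by simp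
      have "u t * (\<integral>y. l y * w y \<partial>J) = (\<integral>y. l y * w y * u t \<partial>J)" by simp
      also have "\<dots> \<le> (\<integral>y. l y * w y * u (fst y) \<partial>J)"
      proof (rule integral_mono[OF _ lw(1)])
        fix y assume "y \<in> space J"
        then have y: "fst y \<in> {0..1}" by (auto simp: space_J)
        show "l y * w y * u t \<le> l y * w y * u (fst y)"
        proof (cases "t \<le> fst y")
          case True
          then have "u t \<le> u (fst y)" using y t1 by (intro mono_onD[OF mono]) auto
          then show ?thesis using l01 w01 by (intro mult_left_mono) auto
        next
          case False
          then show ?thesis by (simp add: w_def threshold_weight_def)
        qed
      qed (use int_lw in simp)
      also have "\<dots> \<le> u t * (4 * (\<integral>y. l y * r y \<partial>J))" using lwu by simp
      finally have "(\<integral>y. l y * w y \<partial>J) \<le> 4 * (\<integral>y. l y * r y \<partial>J)" using ut by simp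
      also have "(\<integral>y. l y * r y \<partial>J) \<le> (\<integral>y. r y \<partial>J)"
        using l01 r01 by (intro integral_mono int_lr int_r) (auto intro: mult_left_le_one_le)
      finally have lw_r: "(\<integral>y. l y * w y \<partial>J) \<le> 4 * (\<integral>y. r y \<partial>J)" by simp
      have int_b: "integrable J (\<lambda>y. l y * w y * (fst y - x))"
      proof -
        have "integrable J (\<lambda>y. l y * w y * fst y)"
          using l01 w01 by (intro int) (auto intro!: mult_le_one)
        then show ?thesis using int_lw by (simp add: right_diff_distrib)
      qed
      \<comment> \<open>Values above x have weight 1 because t \<le> x, so the excess is dominated
        by the pooled value. Split as (v - x) + x, its first part integrates to 0 by
        \<open>balance\<close>.\<close>
      have "(\<integral>y. l y * max 0 (fst y - x) \<partial>J) \<le> (\<integral>y. l y * w y * (fst y - x) + l y * w y * x \<partial>J)"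
      proof (rule integral_mono)
        show "integrable J (\<lambda>y. l y * max 0 (fst y - x))"
          using l01 x by (intro int) (auto intro!: mult_le_one)
        show "integrable J (\<lambda>y. l y * w y * (fst y - x) + l y * w y * x)"
          using int_b int_lw by simp
        fix y assume "y \<in> space J"
        then have y: "fst y \<in> {0..1}" by (auto simp: space_J)
        show "l y * max 0 (fst y - x) \<le> l y * w y * (fst y - x) + l y * w y * x"
        proof (cases "x < fst y")
          case True
          then have "w y = 1" using t by (simp add: w_def threshold_weight_def)
          then show ?thesis using True x l01[of y] by simp
        next
          case False
          have "0 \<le> l y * w y * fst y" using l01 w01 y by simp
          then show ?thesis using False by (simp add: algebra_simps)
        qed
      qed
      also have "\<dots> = x * (\<integral>y. l y * w y \<partial>J)"
        using balance int_b int_lw by (simp add: w_def mult.commute)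
      also have "\<dots> \<le> x * (4 * (\<integral>y. r y \<partial>J))"
        using lw_r x by (intro mult_left_mono) auto
      finally show ?thesis by simp
    qed
  qed
  \<comment> \<open>On the remaining signals the excess is bounded by the value, hence in mean by
    \<open>e\<close>, and r > 1/4 gives the factor 4.\<close>
  have "(\<integral>y. (1 - l y) * max 0 (fst y - x) \<partial>J) \<le> (\<integral>y. (1 - l y) * fst y \<partial>J)"
  proof (rule integral_mono)
    show "integrable J (\<lambda>y. (1 - l y) * max 0 (fst y - x))"
      using l01 x by (intro int) (auto intro!: mult_le_one)
    show "integrable J (\<lambda>y. (1 - l y) * fst y)"
      using l01 by (intro int) (auto intro!: mult_le_one)
    fix y assume "y \<in> space J"
    then show "(1 - l y) * max 0 (fst y - x) \<le> (1 - l y) * fst y"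
      using l01[of y] x by (intro mult_left_mono) (auto simp: space_J)
  qed
  also have "\<dots> = (\<integral>y. (1 - l y) * e (snd y) \<partial>J)"
    unfolding l_def
    by (rule integral_posterior[OF e eq, where C=1 and h="\<lambda>s. 1 - indicator L (e s)"])
      (auto simp: indicator_def)
  also have "\<dots> \<le> (\<integral>y. 4 * (r y * e (snd y)) \<partial>J)"
  proof (rule integral_mono)
    show "integrable J (\<lambda>y. (1 - l y) * e (snd y))"
      using l01 e01 by (intro int) (auto intro!: mult_le_one)
    fix y
    have "(1 - l y) * e (snd y) \<le> (4 * r y) * e (snd y)"
      using l_cases[of y] r01(1)[of y] e01[of "snd y"] by (intro mult_right_mono) auto
    then show "(1 - l y) * e (snd y) \<le> 4 * (r y * e (snd y))" by simp
  qed (use int_re in simp)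
  finally have high: "(\<integral>y. (1 - l y) * max 0 (fst y - x) \<partial>J) \<le> 4 * (\<integral>y. r y * e (snd y) \<partial>J)"
    by simp
  have "(\<integral>y. max 0 (fst y - x) \<partial>J) = (\<integral>y. l y * max 0 (fst y - x) + (1 - l y) * max 0 (fst y - x) \<partial>J)"
    by (simp add: algebra_simps)
  also have "\<dots> = (\<integral>y. l y * max 0 (fst y - x) \<partial>J) + (\<integral>y. (1 - l y) * max 0 (fst y - x) \<partial>J)"
    using l01 x by (intro Bochner_Integration.integral_add int) (auto intro!: mult_le_one)
  finally show ?thesis using low high unfolding RHS LHS by linarith
qed

end

subsection \<open>Aggregation over the agents\<close>

text \<open>A price argument: each of the k chosen values costs at most x plus its excess over x,
  and all agents' excesses together dominate those of any chosen set.\<close>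

lemma first_best_welfare_le:
  assumes k: "1 \<le> k" "k \<le> N" and F: "\<And>i. i \<in> {1..N} \<Longrightarrow> F i \<in> space (prob_algebra unit_borel)"
    and x: "0 \<le> x"
  shows "first_best_welfare N k F \<le> real k * x + (\<Sum>i\<in>{1..N}. \<integral>v. max 0 (v - x) \<partial>F i)"
proof -
  let ?P = "\<Pi>\<^sub>M i\<in>{1..N}. F i"
  have prob: "prob_space (F i)" if "i \<in> {1..N}" for i
    using F[OF that] by (simp add: space_prob_algebra)
  interpret P: prob_space ?P by (intro prob_space_PiM prob)
  have int: "integrable ?P (\<lambda>v. max 0 (v i - x))"
    and eq: "(\<integral>v. max 0 (v i - x) \<partial>?P) = (\<integral>v. max 0 (v - x) \<partial>F i)" if i: "i \<in> {1..N}" for i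
  proof -
    interpret Fi: prob_space "F i" by (rule prob[OF i])
    have sets: "sets (F i) = sets unit_borel" using F[OF i] by (simp add: space_prob_algebra)
    have space: "space (F i) = {0..1}"
      using sets_eq_imp_space_eq[OF sets] by (simp add: space_restrict_space)
    have "(\<lambda>v. max 0 (v - x)) \<in> borel_measurable unit_borel" by measurable
    then have m: "(\<lambda>v. max 0 (v - x)) \<in> borel_measurable (F i)"
      by (simp cong: measurable_cong_sets add: sets)
    have int: "integrable (F i) (\<lambda>v. max 0 (v - x))"
      by (rule Fi.integrable_const_bound[where B=1, OF AE_I2 m]) (use x in \<open>auto simp: space\<close>)
    have c: "(\<lambda>v. v i) \<in> ?P \<rightarrow>\<^sub>M F i" using i by (rule measurable_component_singleton)
    have d: "distr ?P (F i) (\<lambda>v. v i) = F i"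
      using i prob by (intro distr_PiM_component) auto
    show "integrable ?P (\<lambda>v. max 0 (v i - x))"
      by (rule integrable_distr[OF c]) (use int d in simp)
    show "(\<integral>v. max 0 (v i - x) \<partial>?P) = (\<integral>v. max 0 (v - x) \<partial>F i)"
      using integral_distr[OF c m] d by simp
  qed
  have "first_best_welfare N k F \<le> (\<integral>v. real k * x + (\<Sum>i\<in>{1..N}. max 0 (v i - x)) \<partial>?P)"
    unfolding first_best_welfare_def
  proof (rule integral_mono')
    show "integrable ?P (\<lambda>v. real k * x + (\<Sum>i\<in>{1..N}. max 0 (v i - x)))"
      by (rule Bochner_Integration.integrable_add[OF P.integrable_const])
        (rule Bochner_Integration.integrable_sum, rule int)
    fix v :: "nat \<Rightarrow> real"
    show "0 \<le> real k * x + (\<Sum>i\<in>{1..N}. max 0 (v i - x))"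
      using x by (intro add_nonneg_nonneg sum_nonneg) auto
    have fin: "finite {S. S \<subseteq> {1..N} \<and> card S = k}"
      by (rule finite_subset[of _ "Pow {1..N}"]) auto
    have "{1..k} \<in> {S. S \<subseteq> {1..N} \<and> card S = k}" using k by auto
    then have ne: "{S. S \<subseteq> {1..N} \<and> card S = k} \<noteq> {}" by blast
    show "Max ((\<lambda>S. \<Sum>i\<in>S. v i) ` {S. S \<subseteq> {1..N} \<and> card S = k})
        \<le> real k * x + (\<Sum>i\<in>{1..N}. max 0 (v i - x))"
    proof (rule Max.boundedI)
      fix a assume "a \<in> (\<lambda>S. \<Sum>i\<in>S. v i) ` {S. S \<subseteq> {1..N} \<and> card S = k}"
      then obtain S where S: "S \<subseteq> {1..N}" "card S = k" and a: "a = (\<Sum>i\<in>S. v i)" by auto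
      have "a \<le> (\<Sum>i\<in>S. x + max 0 (v i - x))" unfolding a by (rule sum_mono) auto
      also have "\<dots> = real k * x + (\<Sum>i\<in>S. max 0 (v i - x))" by (simp add: sum.distrib S)
      also have "\<dots> \<le> real k * x + (\<Sum>i\<in>{1..N}. max 0 (v i - x))"
        using S by (intro add_left_mono sum_mono2) auto
      finally show "a \<le> real k * x + (\<Sum>i\<in>{1..N}. max 0 (v i - x))" .
    qed (use fin ne in auto)
  qed
  also have "\<dots> = (\<integral>v. real k * x \<partial>?P) + (\<integral>v. (\<Sum>i\<in>{1..N}. max 0 (v i - x)) \<partial>?P)"
    by (rule Bochner_Integration.integral_add[OF P.integrable_const])
      (rule Bochner_Integration.integrable_sum, rule int)
  also have "(\<integral>v. (\<Sum>i\<in>{1..N}. max 0 (v i - x)) \<partial>?P) = (\<Sum>i\<in>{1..N}. \<integral>v. max 0 (v i - x) \<partial>?P)"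
    by (rule Bochner_Integration.integral_sum) (rule int)
  also have "\<dots> = (\<Sum>i\<in>{1..N}. \<integral>v. max 0 (v - x) \<partial>F i)"
    by (rule sum.cong) (simp_all only: eq)
  finally show ?thesis by (simp only: lebesgue_integral_const P.prob_space scaleR_one)
qed

context selection_game
begin

lemma social_welfare_nonneg: "0 \<le> social_welfare N k F Z"
  unfolding social_welfare_def sum_kth_largest[OF k]
proof (rule integral_nonneg_AE)
  show "AE \<sigma> in P. 0 \<le> (\<Sum>i\<in>{1..N}. sel_prob N k (e \<sigma>) i * e \<sigma> i)"
    using AE_e_nonneg
    by eventually_elim (use sel_prob_bounds(1)[OF k] in \<open>auto intro!: sum_nonneg\<close>)
qed

text \<open>Each \<open>w i\<close> serves as the function \<open>R\<close> of the one-agent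
  problem; the bounds add up because the \<open>w i\<close> account for total mass k and for the
  whole welfare.\<close>

lemma first_best_le_social_welfare:
  fixes code :: "real \<Rightarrow> 's"
  assumes code: "inj code" and nash: "nash_equilibrium N k F u Z"
    and cont: "\<And>i. i \<in> {1..N} \<Longrightarrow> continuous_on {0..1} (u i)"
    and mono: "\<And>i. i \<in> {1..N} \<Longrightarrow> mono_on {0..1} (u i)"
    and u0: "\<And>i v. i \<in> {1..N} \<Longrightarrow> v \<in> {0..1} \<Longrightarrow> 0 \<le> u i v"
    and upos: "\<And>i v. i \<in> {1..N} \<Longrightarrow> v \<in> {0<..1} \<Longrightarrow> 0 < u i v"
  shows "first_best_welfare N k F \<le> 14 * social_welfare N k F Z"
proof -
  let ?SW = "social_welfare N k F Z" and ?pm = "\<lambda>i. posterior_mean (F i) (Z i)"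
  have bound: "first_best_welfare N k F \<le> 5 * (real k * x) + 4 * ?SW"
    if x: "0 < x" "2 * ?SW \<le> real k * x" for x
  proof -
    have agent: "(\<integral>v. max 0 (v - x) \<partial>F i) \<le> 4 * x * (\<integral>s. w i (?pm i s) \<partial>law i)
        + 4 * (\<integral>s. w i (?pm i s) * ?pm i s \<partial>law i)" if i: "i \<in> {1..N}" for i
    proof (rule signaling.equilibrium_bound[OF signaling[OF i] code x(1) w_measurable[OF i]])
      show u: "u i \<in> borel_measurable unit_borel"
        by (rule borel_measurable_continuous_on_restrict[OF cont[OF i]])
      have uB: "\<bar>u i v\<bar> \<le> u i 1" if "v \<in> {0..1}" for v
        using that u0[OF i that] by (auto intro: mono_onD[OF mono[OF i]])
      fix Z' :: "'s scheme" assume Z': "signaling_scheme Z'"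
      \<comment> \<open>Reading the deviated profile as another game makes
        \<open>expected_utility_eq\<close> available for it, with the same
        \<open>w i\<close>.\<close>
      interpret dev: selection_game N k F "Z(i := Z')"
        using k priors schemes Z' by unfold_locales auto
      have utility: "expected_utility N k F u Z i
          = (\<integral>y. w i (posterior_mean (F i) (Z i) (snd y)) * u i (fst y) \<partial>joint_law (F i) (Z i))"
        using i u uB by (rule expected_utility_eq)
      have deviation: "expected_utility N k F u (Z(i := Z')) i
          = (\<integral>y. w i (posterior_mean (F i) Z' (snd y)) * u i (fst y) \<partial>joint_law (F i) Z')"
        using dev.expected_utility_eq[of i u "u i 1"] i u uB by (simp add: win_prob_fun_upd)
      have "expected_utility N k F u (Z(i := Z')) i \<le> expected_utility N k F u Z i"
        using nash i Z' by (auto simp: nash_equilibrium_def)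
      then show "(\<integral>y. w i (posterior_mean (F i) Z' (snd y)) * u i (fst y) \<partial>joint_law (F i) Z')
          \<le> (\<integral>y. w i (posterior_mean (F i) (Z i) (snd y)) * u i (fst y) \<partial>joint_law (F i) (Z i))"
        by (simp only: utility deviation)
    next
      fix a assume "x \<le> a"
      interpret prob_space P by (rule prob_space_P)
      have [measurable]: "(\<lambda>\<sigma>. kth_largest N (e \<sigma>) k) \<in> borel_measurable P"
        using borel_measurable_kth_largest[OF k, of "\<lambda>j \<sigma>. e \<sigma> j" P] by simp
      have "1/2 \<le> measure P {\<sigma> \<in> space P. kth_largest N (e \<sigma>) k < x}"
        by (rule prob_kth_largest_less[OF x])
      also have "\<dots> \<le> measure P {\<sigma> \<in> space P. kth_largest N (e \<sigma>) k < a}"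
        using \<open>x \<le> a\<close> by (intro finite_measure_mono) auto
      also have "\<dots> \<le> w i a" by (rule w_ge[OF i])
      finally show "1/2 \<le> w i a" .
    qed (use i mono u0 upos w_bounds in auto)
    have "first_best_welfare N k F \<le> real k * x + (\<Sum>i\<in>{1..N}. \<integral>v. max 0 (v - x) \<partial>F i)"
      using x by (intro first_best_welfare_le[OF k priors]) auto
    also have "(\<Sum>i\<in>{1..N}. \<integral>v. max 0 (v - x) \<partial>F i)
        \<le> (\<Sum>i\<in>{1..N}. 4 * x * (\<integral>s. w i (?pm i s) \<partial>law i) + 4 * (\<integral>s. w i (?pm i s) * ?pm i s \<partial>law i))"
      by (rule sum_mono) (rule agent)
    also have "\<dots> = 4 * x * real k + 4 * ?SW"
      by (simp only: sum.distrib sum_distrib_left[symmetric] sum_integral_w social_welfare_eq)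
    finally show ?thesis by (simp add: mult_ac)
  qed
  have "first_best_welfare N k F \<le> 14 * ?SW + \<epsilon>" if \<epsilon>: "0 < \<epsilon>" for \<epsilon>
  proof -
    \<comment> \<open>The welfare might be 0 while x must be positive, hence the slack. The fifth
      compensates the factor 5 in \<open>bound\<close>: 5 (2 SW + \<epsilon>/5) + 4 SW = 14 SW +
      \<epsilon>.\<close>
    define x where "x = (2 * ?SW + \<epsilon> / 5) / real k"
    have "real k * x = 2 * ?SW + \<epsilon> / 5" using k by (simp add: x_def)
    moreover have "0 < x" unfolding x_def using k \<epsilon> social_welfare_nonneg
      by (intro divide_pos_pos) auto
    ultimately show ?thesis using bound[of x] \<epsilon> by simp
  qed
  then show ?thesis by (rule field_le_epsilon)
qed

end

theorem theorem5p1: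
  fixes N k :: nat
    and F :: "nat \<Rightarrow> real measure"
    and u :: "nat \<Rightarrow> real \<Rightarrow> real"
  assumes universe: "\<exists>code :: real \<Rightarrow> 's. inj code"
    and "1 \<le> k" and "k \<le> N"
    and "\<forall>i\<in>{1..N}. F i \<in> space (prob_algebra unit_borel)"
    and "\<forall>i\<in>{1..N}. continuous_on {0..1} (u i)"
    and "\<forall>i\<in>{1..N}. mono_on {0..1} (u i)"
    and "\<forall>i\<in>{1..N}. \<forall>v\<in>{0..1}. 0 \<le> u i v"
    and "\<forall>i\<in>{1..N}. \<forall>v\<in>{0<..1}. 0 < u i v"
    and "\<exists>Z :: nat \<Rightarrow> 's scheme. nash_equilibrium N k F u Z"
  shows "price_of_anarchy TYPE('s) N k F u \<le> ereal (11 + 5 * sqrt 5) \<and>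
    (\<forall>Z :: nat \<Rightarrow> 's scheme. nash_equilibrium N k F u Z \<longrightarrow>
       first_best_welfare N k F \<le> (11 + 5 * sqrt 5) * social_welfare N k F Z)"
proof -
  let ?c = "11 + 5 * sqrt 5" and ?FB = "first_best_welfare N k F"
  obtain code :: "real \<Rightarrow> 's" where code: "inj code" using universe by blast
  have "2 \<le> sqrt 5" by (rule real_le_rsqrt) simp
  then have c: "14 \<le> ?c" by simp
  have game: "selection_game N k F Z" if "nash_equilibrium N k F u Z" for Z :: "nat \<Rightarrow> 's scheme"
    using assms(2-4) that by unfold_locales (auto simp: nash_equilibrium_def)
  have main: "?FB \<le> ?c * social_welfare N k F Z" "0 \<le> social_welfare N k F Z"
    if Z: "nash_equilibrium N k F u Z" for Z :: "nat \<Rightarrow> 's scheme"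
  proof -
    interpret selection_game N k F Z by (rule game[OF Z])
    show nn: "0 \<le> social_welfare N k F Z" by (rule social_welfare_nonneg)
    have "?FB \<le> 14 * social_welfare N k F Z"
      using assms(5-8) by (intro first_best_le_social_welfare[OF code Z]) auto
    also have "\<dots> \<le> ?c * social_welfare N k F Z" using c nn by (rule mult_right_mono)
    finally show "?FB \<le> ?c * social_welfare N k F Z" .
  qed
  define I where "I = (INF Z\<in>{Z :: nat \<Rightarrow> 's scheme. nash_equilibrium N k F u Z}. ereal (social_welfare N k F Z))"
  have I0: "0 \<le> I" unfolding I_def using main(2) by (intro INF_greatest) auto
  \<comment> \<open>Dividing by the positive constant gives one lower bound for the welfare of all
    equilibria, which passes to the infimum.\<close>
  have "ereal (?FB / ?c) \<le> I"
    unfolding I_def using main(1) c by (intro INF_greatest) (auto simp: divide_simps mult.commute)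
  then have FB: "ereal ?FB \<le> ereal ?c * I"
    using c by (cases I) (auto simp: divide_simps mult.commute)
  have "I \<noteq> \<infinity>"
  proof -
    obtain Z :: "nat \<Rightarrow> 's scheme" where "nash_equilibrium N k F u Z" using assms(9) by blast
    then have "I \<le> ereal (social_welfare N k F Z)" unfolding I_def by (intro INF_lower) auto
    then show ?thesis by auto
  qed
  then obtain r where r: "I = ereal r" "0 \<le> r" using I0 by (cases I) auto
  have "ereal ?FB / I \<le> ereal ?c"
  \<comment> \<open>With infimum 0 the quotient could be infinite; but then \<open>FB\<close> makes
    the first-best welfare at most 0, and the extended quotient is at most 0.\<close>
  proof (cases "r = 0")
    case True
    with FB r have "?FB \<le> 0" by simp
    then have "ereal ?FB / I \<le> 0" using True r by (simp add: divide_ereal_def)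
    also have "\<dots> \<le> ereal ?c" using c by simp
    finally show ?thesis .
  next
    case False
    then show ?thesis using FB r by (simp add: divide_simps)
  qed
  then show ?thesis using main(1) by (auto simp: price_of_anarchy_def I_def)
qed

end
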